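(* Let $\mathbb{FP}^{d-1}$ be one of the projective spaces $\mathbb{RP}^{d-1}$, $\mathbb{CP}^{d-1}$, $\mathbb{HP}^{d-1}$ ($d\ge 2$) or $\mathbb{OP}^2$ (where $d=3$). Let $(X_N)_{N\in\mathbb{N}}$ be a sequence of finite point sets in $\mathbb{FP}^{d-1}$ with $\lim_{N\to\infty}\#X_N=\infty$ that is hyperuniform for balls at threshold order. Then $(X_N)_{N\in\mathbb{N}}$ is uniformly distributed.
   Context: Spaces. $\mathbb{F}\in\{\mathbb{R},\mathbb{C},\mathbb{H},\mathbb{O}\}$ with $\dim_{\mathbb{R}}(\mathbb{F})=1,2,4,8$ respectively; as homogeneous spaces $\mathbb{RP}^{d-1}\cong \mathrm{O}(d)/(\mathrm{O}(d-1)\times\mathrm{O}(1))$, $\mathbb{CP}^{d-1}\cong \mathrm{U}(d)/(\mathrm{U}(d-1)\times\mathrm{U}(1))$, $\mathbb{HP}^{d-1}\cong \mathrm{Sp}(d)/(\mathrm{Sp}(d-1)\times\mathrm{Sp}(1))$, $\mathbb{OP}^2\cong \mathrm{F}_4/\mathrm{Spin}(9)$. The real dimension is $D=(d-1)\dim_{\mathbb{R}}(\mathbb{F})$. Metric and measure. $\vartheta$ is the invariant geodesic metric, normalised to take values in $[0,\frac{\pi}{2}]$. (Concretely, for $\mathbb{F}=\mathbb{R},\mathbb{C},\mathbb{H}$, points are $\mathbb{F}$-lines in $\mathbb{F}^d$ and $\cos\vartheta=|\langle u,v\rangle|$ for unit vectors $u,v$ spanning the lines; for $\mathbb{OP}^2$,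 points are the idempotents $P$ of trace $1$ in the Albert algebra of Hermitian $3\times 3$ octonionic matrices and $\cos^2\vartheta(P,Q)=\mathrm{Tr}(P\circ Q)$.) $\sigma$ is the normalised (probability) surface measure, invariant under the isometry group. $B(x,r)=\{y\in\mathbb{FP}^{d-1}\mid\vartheta(x,y)<r\}$; its measure $\sigma(B(x,r))$ does not depend on $x$. Number variance. For a finite set $X_N$, $$\mathbb{V}(X_N,r)=\int_{\mathbb{FP}^{d-1}}\Big(\sum_{y\in X_N}\mathbb{1}_{B(x,r)}(y)-\#X_N\,\sigma(B(x,r))\Big)^2d\sigma(x).$$ Hyperuniform for balls at threshold order: $$\limsup_{N\to\infty}\mathbb{V}\big(X_N,r(\#X_N)^{-1/D}\big)=\mathcal{O}(r^{D-1})\quad\text{as } r\to\infty.$$ Uniformly distributed: for all $x\in\mathbb{FP}^{d-1}$ and $r\in[0,\frac{\pi}{2}]$, $\lim_{N\to\infty}\frac{1}{\#X_N}\sum_{y\in X_N}\mathbb{1}_{B(x,r)}(y)=\sigma(B(x,r))$. *)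

theory Defs
  imports "HOL-Analysis.Analysis"
begin

section \<open>Quaternions and octonions by Cayley--Dickson doubling\<close>

text \<open>
  The product types carry the Euclidean structure of \<open>\<real>\<^sup>4\<close> and \<open>\<real>\<^sup>8\<close>, so \<^const>\<open>norm\<close> is the
  usual modulus.  The doubling convention is \<open>(a, b) (c, d) = (a c - d\<^sup>* b, d a + b c\<^sup>*)\<close>.
\<close>

type_synonym quaternion = "complex \<times> complex"
type_synonym octonion = "quaternion \<times> quaternion"

definition qmult :: "quaternion \<Rightarrow> quaternion \<Rightarrow> quaternion" where
  "qmult x y =
     (fst x * fst y - cnj (snd y) * snd x, snd y * fst x + snd x * cnj (fst y))"

definition qcnj :: "quaternion \<Rightarrow> quaternion" where
  "qcnj x = (cnj (fst x), - snd x)"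

definition omult :: "octonion \<Rightarrow> octonion \<Rightarrow> octonion" where
  "omult x y =
     (qmult (fst x) (fst y) - qmult (qcnj (snd y)) (snd x),
      qmult (snd y) (fst x) + qmult (snd x) (qcnj (fst y)))"

definition ocnj :: "octonion \<Rightarrow> octonion" where
  "ocnj x = (qcnj (fst x), - snd x)"

definition oreal :: "real \<Rightarrow> octonion" where
  "oreal t = ((of_real t, 0), 0)"

definition oRe :: "octonion \<Rightarrow> real" where
  "oRe x = Re (fst (fst x))"

lemma qmult_assoc: "qmult (qmult x y) z = qmult x (qmult y z)"
  by (simp add: qmult_def algebra_simps)

lemma norm_qmult: "norm (qmult x y) = norm x * norm y"
proof -
  have "(norm (qmult x y))\<^sup>2 = (norm x * norm y)\<^sup>2"
    by (simp add: qmult_def norm_prod_def cmod_def power_mult_distrib)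
       (simp add: power2_eq_square algebra_simps)
  then show ?thesis
    by (simp add: power2_eq_iff_nonneg)
qed

lemma norm_omult: "norm (omult x y) = norm x * norm y"
proof -
  have "(norm (omult x y))\<^sup>2 = (norm x * norm y)\<^sup>2"
    by (simp add: omult_def ocnj_def qmult_def qcnj_def norm_prod_def cmod_def power_mult_distrib)
       (simp add: power2_eq_square algebra_simps)
  then show ?thesis
    by (simp add: power2_eq_iff_nonneg)
qed


section \<open>Projective spaces over the reals, complex numbers and quaternions\<close>

text \<open>
  The multiplication and the conjugation of the scalars are parameters, since the quaternions above
  are not a ring type.  Vectors are columns and scalars act on the right, so that
  \<open>|\<langle>u, v\<rangle>|\<close> with \<open>\<langle>u, v\<rangle> = \<Sum>\<^sub>i u\<^sub>i\<^sup>* v\<^sub>i\<close> depends only on the lines spanned by the unit vectors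
  \<open>u\<close> and \<open>v\<close>, also over the quaternions.
\<close>

definition span_line :: "('a \<Rightarrow> 'a \<Rightarrow> 'a) \<Rightarrow> 'a ^ 'n \<Rightarrow> ('a ^ 'n) set" where
  "span_line mul u = range (\<lambda>c. \<chi> i. mul (u $ i) c)"

definition proj_space :: "('a::zero \<Rightarrow> 'a \<Rightarrow> 'a) \<Rightarrow> ('a ^ 'n) set set" where
  "proj_space mul = {span_line mul u | u. u \<noteq> 0}"

definition herm_inner ::
    "('a \<Rightarrow> 'a \<Rightarrow> 'a) \<Rightarrow> ('a \<Rightarrow> 'a) \<Rightarrow> 'a ^ 'n \<Rightarrow> 'a ^ 'n \<Rightarrow> 'a::comm_monoid_add" where
  "herm_inner mul star u v = (\<Sum>i\<in>UNIV. mul (star (u $ i)) (v $ i))"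

definition proj_dist ::
    "('a::real_normed_vector \<Rightarrow> 'a \<Rightarrow> 'a) \<Rightarrow> ('a \<Rightarrow> 'a) \<Rightarrow> ('a ^ 'n) set \<Rightarrow> ('a ^ 'n) set \<Rightarrow> real" where
  "proj_dist mul star L M =
     (THE t. \<exists>u\<in>L. \<exists>v\<in>M. norm u = 1 \<and> norm v = 1 \<and> t = arccos (norm (herm_inner mul star u v)))"

definition RP :: "(real ^ 'n) set set" where
  "RP = proj_space (*)"

definition RP_dist :: "(real ^ 'n) set \<Rightarrow> (real ^ 'n) set \<Rightarrow> real" where
  "RP_dist = proj_dist (*) (\<lambda>x. x)"

definition CP :: "(complex ^ 'n) set set" where
  "CP = proj_space (*)"

definition CP_dist :: "(complex ^ 'n) set \<Rightarrow> (complex ^ 'n) set \<Rightarrow> real" where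
  "CP_dist = proj_dist (*) cnj"

definition HP :: "(quaternion ^ 'n) set set" where
  "HP = proj_space qmult"

definition HP_dist :: "(quaternion ^ 'n) set \<Rightarrow> (quaternion ^ 'n) set \<Rightarrow> real" where
  "HP_dist = proj_dist qmult qcnj"


section \<open>The octonionic projective plane\<close>

type_synonym omatrix = "octonion ^ 3 ^ 3"

definition omat_mult :: "omatrix \<Rightarrow> omatrix \<Rightarrow> omatrix" where
  "omat_mult A B = (\<chi> i j. \<Sum>k\<in>UNIV. omult (A $ i $ k) (B $ k $ j))"

definition albert :: "omatrix set" where
  "albert = {A. \<forall>i j. A $ j $ i = ocnj (A $ i $ j)}"

definition jordan_mult :: "omatrix \<Rightarrow> omatrix \<Rightarrow> omatrix" where
  "jordan_mult A B = (1/2) *\<^sub>R (omat_mult A B + omat_mult B A)"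

definition otrace :: "omatrix \<Rightarrow> octonion" where
  "otrace A = (\<Sum>i\<in>UNIV. A $ i $ i)"

definition OP2 :: "omatrix set" where
  "OP2 = {P \<in> albert. jordan_mult P P = P \<and> otrace P = oreal 1}"

text \<open>The trace of an element of the Albert algebra is real, so \<^const>\<open>oRe\<close> only changes its type.\<close>

definition OP2_dist :: "omatrix \<Rightarrow> omatrix \<Rightarrow> real" where
  "OP2_dist P Q = arccos (sqrt (oRe (otrace (jordan_mult P Q))))"


section \<open>Invariant measure, number variance, hyperuniformity\<close>

text \<open>
  From here on \<open>S\<close> is the set of points, \<open>\<theta>\<close> the metric on \<open>S\<close>, \<open>\<sigma>\<close> a measure on \<open>S\<close>, and \<open>D\<close> the
  real dimension.
\<close>

definition isometry_of :: "'p set \<Rightarrow> ('p \<Rightarrow> 'p \<Rightarrow> real) \<Rightarrow> ('p \<Rightarrow> 'p) \<Rightarrow> bool" where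
  "isometry_of S \<theta> f \<longleftrightarrow> bij_betw f S S \<and> (\<forall>x\<in>S. \<forall>y\<in>S. \<theta> (f x) (f y) = \<theta> x y)"

text \<open>
  The locale \<^locale>\<open>Metric_space\<close> requires nonnegativity and symmetry of the distance on the whole
  type and not only on the carrier.  The distances above are arbitrary outside their carriers, so
  balls and open sets are written out.
\<close>

definition ball_of :: "'p set \<Rightarrow> ('p \<Rightarrow> 'p \<Rightarrow> real) \<Rightarrow> 'p \<Rightarrow> real \<Rightarrow> 'p set" where
  "ball_of S \<theta> x r = {y \<in> S. \<theta> x y < r}"

definition open_sets_of :: "'p set \<Rightarrow> ('p \<Rightarrow> 'p \<Rightarrow> real) \<Rightarrow> 'p set set" where
  "open_sets_of S \<theta> = {U. U \<subseteq> S \<and> (\<forall>x\<in>U. \<exists>r>0. ball_of S \<theta> x r \<subseteq> U)}"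

text \<open>
  On a compact metric space with transitive isometry group there is exactly one isometry-invariant
  Borel probability measure; on the spaces above it is the normalised surface measure.
\<close>

definition invariant_prob :: "'p set \<Rightarrow> ('p \<Rightarrow> 'p \<Rightarrow> real) \<Rightarrow> 'p measure \<Rightarrow> bool" where
  "invariant_prob S \<theta> \<sigma> \<longleftrightarrow>
     space \<sigma> = S \<and>
     sets \<sigma> = sigma_sets S (open_sets_of S \<theta>) \<and>
     emeasure \<sigma> S = 1 \<and>
     (\<forall>f. isometry_of S \<theta> f \<longrightarrow> (\<forall>A\<in>sets \<sigma>. emeasure \<sigma> (f ` A) = emeasure \<sigma> A))"

definition number_variance ::
    "'p set \<Rightarrow> ('p \<Rightarrow> 'p \<Rightarrow> real) \<Rightarrow> 'p measure \<Rightarrow> 'p set \<Rightarrow> real \<Rightarrow> real" where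
  "number_variance S \<theta> \<sigma> X r =
     (\<integral>x. ((\<Sum>y\<in>X. indicator (ball_of S \<theta> x r) y)
            - real (card X) * measure \<sigma> (ball_of S \<theta> x r))\<^sup>2 \<partial>\<sigma>)"

text \<open>
  The limes superior is taken in the extended reals, so the bound includes its finiteness for all
  large \<open>r\<close>; it is nonnegative, so no absolute value is needed.
\<close>

definition hyperuniform_threshold ::
    "'p set \<Rightarrow> ('p \<Rightarrow> 'p \<Rightarrow> real) \<Rightarrow> 'p measure \<Rightarrow> nat \<Rightarrow> (nat \<Rightarrow> 'p set) \<Rightarrow> bool" where
  "hyperuniform_threshold S \<theta> \<sigma> D X \<longleftrightarrow>
     (\<exists>C::real. \<forall>\<^sub>F r in at_top.
        limsup (\<lambda>N. ereal (number_variance S \<theta> \<sigma> (X N) (r * real (card (X N)) powr (- 1 / real D))))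
          \<le> ereal (C * r ^ (D - 1)))"

definition uniformly_distributed ::
    "'p set \<Rightarrow> ('p \<Rightarrow> 'p \<Rightarrow> real) \<Rightarrow> 'p measure \<Rightarrow> (nat \<Rightarrow> 'p set) \<Rightarrow> bool" where
  "uniformly_distributed S \<theta> \<sigma> X \<longleftrightarrow>
     (\<forall>x\<in>S. \<forall>r\<in>{0..pi/2}.
        (\<lambda>N. 1 / real (card (X N)) * (\<Sum>y\<in>X N. indicator (ball_of S \<theta> x r) y))
          \<longlonglongrightarrow> measure \<sigma> (ball_of S \<theta> x r))"

definition point_sets :: "'p set \<Rightarrow> (nat \<Rightarrow> 'p set) \<Rightarrow> bool" where
  "point_sets S X \<longleftrightarrow>
     (\<forall>N. finite (X N) \<and> X N \<subseteq> S) \<and> filterlim (\<lambda>N. card (X N)) at_top sequentially"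

end

(*
  Embed the space into Hermitian matrices by the rank one projections.  Since
  cos^2 theta(x, y) is the inner product of the projections, geodesic balls of radius r <= pi/2 are
  chordal balls, and the chordal distance satisfies the triangle inequality.

  Let n = #X_N, let b be the measure of a ball of radius rho = r n^(-1/D), and integrate the
  discrepancy sum_y 1_B(x,rho)(y) - n b over a fixed ball A of radius R + rho or R - rho.  The integral
  is at most the square root of the variance, and it compares the number of points in the ball of
  radius R with n sigma(A).  Hence #(X_N in the ball)/n lies between sigma(A_-) and sigma(A_+) up to
  sqrt V / (n b), which is O(r^((D-1)/2 - D)) because b >= c rho^D; let N and then r tend to infinity.

  The lower bound for b comes from a cover by O(rho^-D) balls, read off in affine charts.  Spheres
  are null sets: by transitivity all spheres of the same radius have the same measure, and there is
  an infinite sequence of centres such that every point lies on a bounded number of these spheres.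
*)
theory Submission
  imports Defs "HOL-Probability.Probability" "HOL-Real_Asymp.Real_Asymp"
begin

section \<open>Hyperuniformity on a homogeneous chordal space\<close>

text \<open>The measure is known only through its invariance, so volumes have to come from counting:
  coverings bound balls from below, multiplicities of spheres bound spheres from above. Spheres
  matter because the threshold radius shrinks to 0 and the comparison radii squeeze R from both
  sides; the two bounds agree in the limit if the volume of a ball is continuous in its radius.
  Bounded multiplicity is an algebraic fact. In a chart, a sphere about x is the zero set of a
  quadratic form, and along a curve with sparse exponents this form becomes a nonzero polynomial of
  bounded degree. The octonionic plane is the obstacle to a common treatment, since vectors over a
  nonassociative algebra do not span lines. The interface shared by the four families therefore
  speaks of vectors with one coordinate equal to \<open>one\<close>, whose projections make sense in
  every case. Transitivity is proved separately: by Householder reflections for associative scalars,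
  and by real orthogonal conjugations together with Moufang maps for the octonions.\<close>

lemma isometry_of_inv:
  assumes "isometry_of S \<theta> f" "x \<in> S"
  shows "\<exists>g. isometry_of S \<theta> g \<and> g (f x) = x"
proof (intro exI conjI)
  have b: "bij_betw f S S" and i: "\<And>x y. x \<in> S \<Longrightarrow> y \<in> S \<Longrightarrow> \<theta> (f x) (f y) = \<theta> x y"
    using assms(1) by (auto simp: isometry_of_def)
  let ?g = "inv_into S f"
  have "?g y \<in> S" "f (?g y) = y" if "y \<in> S" for y
    using that b by (auto simp: bij_betw_def f_inv_into_f inv_into_into)
  then show "isometry_of S \<theta> ?g"
    unfolding isometry_of_def using b i by (metis bij_betw_inv_into)
  show "?g (f x) = x"
    using b assms(2) by (simp add: bij_betw_def)
qed

lemma isometry_of_comp: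
  assumes "isometry_of S \<theta> f" "isometry_of S \<theta> g"
  shows "isometry_of S \<theta> (\<lambda>x. g (f x))"
proof -
  have "bij_betw (g \<circ> f) S S"
    using assms by (auto simp: isometry_of_def intro: bij_betw_trans)
  moreover have "f x \<in> S" if "x \<in> S" for x
    using assms that by (auto simp: isometry_of_def bij_betw_def)
  ultimately show ?thesis
    using assms by (auto simp: isometry_of_def comp_def)
qed

lemma isometry_ofI:
  assumes "\<And>x. x \<in> S \<Longrightarrow> f x \<in> S" "\<And>x. x \<in> S \<Longrightarrow> g x \<in> S"
    and "\<And>x. x \<in> S \<Longrightarrow> g (f x) = x" "\<And>x. x \<in> S \<Longrightarrow> f (g x) = x"
    and "\<And>x y. x \<in> S \<Longrightarrow> y \<in> S \<Longrightarrow> \<theta> (f x) (f y) = \<theta> x y"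
  shows "isometry_of S \<theta> f"
  unfolding isometry_of_def
  using bij_betw_byWitness[of S g f S] assms by blast

text \<open>Cauchy-Schwarz only places the inner products in [-1, 1]. As \<open>sqrt\<close> is an
  odd function here, a negative \<open>c\<close> makes both sides false, so its sign needs no
  discussion.\<close>

lemma arccos_sqrt_less_iff:
  assumes "\<bar>c\<bar> \<le> 1" "0 \<le> r" "r \<le> pi / 2"
  shows "arccos (sqrt c) < r \<longleftrightarrow> 1 - c < (sin r)\<^sup>2"
proof -
  have s: "\<bar>sqrt c\<bar> \<le> 1"
    using assms(1) by (auto simp: abs_le_iff real_sqrt_le_1_iff intro: order_trans[OF _ real_sqrt_le_mono])
      (metis minus_le_iff real_sqrt_le_1_iff real_sqrt_minus)
  have cr: "0 \<le> cos r"
    using assms by (intro cos_ge_zero) auto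
  have "arccos (sqrt c) < r \<longleftrightarrow> arccos (sqrt c) < arccos (cos r)"
    using assms by (subst arccos_cos) auto
  also have "\<dots> \<longleftrightarrow> cos r < sqrt c"
    using s by (intro arccos_less_mono) auto
  also have "\<dots> \<longleftrightarrow> (cos r)\<^sup>2 < c"
    using cr real_sqrt_less_iff[of "(cos r)\<^sup>2" c] by simp
  finally show ?thesis
    unfolding sin_squared_eq by linarith
qed

section \<open>Chordal geometry of a homogeneous space\<close>

text \<open>The last inputs are free of measure theory, so that each concrete space can verify them
  by algebra: \<open>cover\<close> yields the lower volume bound of order \<open>D\<close>, and
  \<open>general_position\<close> makes spheres null. Its bound \<open>m\<close> is uniform in the
  point and in the radius.\<close>

locale chordal_space =
  fixes S :: "'p set" and \<theta> :: "'p \<Rightarrow> 'p \<Rightarrow> real" and \<phi> :: "'p \<Rightarrow> 'e::real_inner" and D :: nat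
  assumes norm_phi: "x \<in> S \<Longrightarrow> norm (\<phi> x) = 1"
    and theta_eq: "x \<in> S \<Longrightarrow> y \<in> S \<Longrightarrow> \<theta> x y = arccos (sqrt (\<phi> x \<bullet> \<phi> y))"
    and transitive: "x \<in> S \<Longrightarrow> y \<in> S \<Longrightarrow> \<exists>f. isometry_of S \<theta> f \<and> f x = y"
    and cover: "\<exists>K. \<forall>\<rho>. 0 < \<rho> \<longrightarrow> \<rho> \<le> 1 \<longrightarrow>
      (\<exists>T\<subseteq>S. finite T \<and> real (card T) * \<rho> ^ D \<le> K \<and> (\<forall>x\<in>S. \<exists>y\<in>T. norm (\<phi> x - \<phi> y) < \<rho>))"
    and general_position: "\<exists>(\<gamma> :: nat \<Rightarrow> 'p) m. range \<gamma> \<subseteq> S \<and>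
      (\<forall>x\<in>S. \<forall>R>0. finite {t. norm (\<phi> x - \<phi> (\<gamma> t)) = R} \<and> card {t. norm (\<phi> x - \<phi> (\<gamma> t)) = R} \<le> m)"
    and D_pos: "0 < D"
begin

abbreviation chord :: "'p \<Rightarrow> 'p \<Rightarrow> real" where
  "chord x y \<equiv> norm (\<phi> x - \<phi> y)"

definition chordal_ball :: "'p \<Rightarrow> real \<Rightarrow> 'p set" where
  "chordal_ball x R = {y \<in> S. chord x y < R}"

lemma chord_sq: "x \<in> S \<Longrightarrow> y \<in> S \<Longrightarrow> (chord x y)\<^sup>2 = 2 - 2 * (\<phi> x \<bullet> \<phi> y)"
  using norm_phi[of x] norm_phi[of y]
  by (simp add: power2_norm_eq_inner inner_diff_left inner_diff_right inner_commute norm_eq_1)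

lemma abs_inner_le: "x \<in> S \<Longrightarrow> y \<in> S \<Longrightarrow> \<bar>\<phi> x \<bullet> \<phi> y\<bar> \<le> 1"
  using Cauchy_Schwarz_ineq2[of "\<phi> x" "\<phi> y"] by (simp add: norm_phi)

text \<open>For unit vectors the squared chord is 2 - 2 cos^2 = 2 sin^2 of the angle, which is the
  origin of the factor \<open>sqrt 2\<close>. On [0, pi/2] the comparison can be squared without
  loss.\<close>

lemma theta_less_iff:
  assumes "x \<in> S" "y \<in> S" "0 \<le> r" "r \<le> pi / 2"
  shows "\<theta> x y < r \<longleftrightarrow> chord x y < sqrt 2 * sin r"
proof -
  have "0 \<le> sin r"
    using assms by (intro sin_ge_zero) auto
  then have "chord x y < sqrt 2 * sin r \<longleftrightarrow> (chord x y)\<^sup>2 < (sqrt 2 * sin r)\<^sup>2"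
    by (metis (no_types) mult_nonneg_nonneg norm_ge_zero power_less_imp_less_base power_strict_mono
        real_sqrt_ge_zero zero_le_numeral zero_less_numeral)
  also have "\<dots> \<longleftrightarrow> 1 - \<phi> x \<bullet> \<phi> y < (sin r)\<^sup>2"
    using assms by (simp add: chord_sq power_mult_distrib) linarith
  finally show ?thesis
    using assms arccos_sqrt_less_iff[OF abs_inner_le] by (simp add: theta_eq)
qed

lemma ball_of_eq:
  assumes "x \<in> S" "0 \<le> r" "r \<le> pi / 2"
  shows "ball_of S \<theta> x r = chordal_ball x (sqrt 2 * sin r)"
  using assms by (auto simp: ball_of_def chordal_ball_def theta_less_iff)

text \<open>Both \<open>arccos\<close> on [-1, 1] and the odd \<open>sqrt\<close> are injective, so
  \<open>\<theta>\<close> determines the inner product and hence the chord.\<close>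

lemma isometry_chord:
  assumes "isometry_of S \<theta> f" "x \<in> S" "y \<in> S"
  shows "chord (f x) (f y) = chord x y"
proof -
  have mem: "f x \<in> S" "f y \<in> S"
    using assms by (auto simp: isometry_of_def bij_betw_def)
  have s: "\<bar>sqrt (\<phi> u \<bullet> \<phi> v)\<bar> \<le> 1" if "u \<in> S" "v \<in> S" for u v
    using abs_inner_le[OF that] by (simp flip: real_sqrt_abs' add: real_sqrt_abs2)
  have "arccos (sqrt (\<phi> (f x) \<bullet> \<phi> (f y))) = arccos (sqrt (\<phi> x \<bullet> \<phi> y))"
    using assms mem unfolding isometry_of_def by (metis theta_eq)
  then have "\<phi> (f x) \<bullet> \<phi> (f y) = \<phi> x \<bullet> \<phi> y"
    using s mem assms by (subst (asm) arccos_eq_iff) auto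
  then have "(chord (f x) (f y))\<^sup>2 = (chord x y)\<^sup>2"
    using assms mem by (simp add: chord_sq)
  then show ?thesis
    by (simp add: power2_eq_iff_nonneg)
qed

text \<open>The predicate \<open>P\<close> covers balls and spheres at once.\<close>

lemma isometry_image:
  assumes f: "isometry_of S \<theta> f" and x: "x \<in> S"
  shows "f ` {y \<in> S. P (chord x y)} = {y \<in> S. P (chord (f x) y)}"
proof -
  have b: "f ` S = S"
    using f by (simp add: isometry_of_def bij_betw_def)
  show ?thesis
  proof (intro equalityI subsetI)
    fix z assume "z \<in> {y \<in> S. P (chord (f x) y)}"
    then obtain y where "y \<in> S" "z = f y" "P (chord (f x) (f y))"
      using b by (metis (mono_tags, lifting) imageE mem_Collect_eq)
    then show "z \<in> f ` {y \<in> S. P (chord x y)}"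
      using isometry_chord[OF f x] by auto
  qed (use b isometry_chord[OF f x] in auto)
qed

text \<open>This bridge makes chords measurable, since the sigma-algebra is generated by the
  \<open>\<theta>\<close>-open sets. The triangle inequality of the norm leaves a margin
  \<open>e\<close>, and \<open>sqrt 2 * sin r\<close> tends to 0, so some positive angle fits into
  it.\<close>

lemma chordal_ball_open: "chordal_ball x R \<in> open_sets_of S \<theta>"
  unfolding open_sets_of_def
proof (intro CollectI conjI ballI)
  show "chordal_ball x R \<subseteq> S"
    by (auto simp: chordal_ball_def)
  fix y assume y: "y \<in> chordal_ball x R"
  define e where "e = R - chord x y"
  have e: "e > 0" "y \<in> S"
    using y by (auto simp: chordal_ball_def e_def)
  have "((\<lambda>r. sqrt 2 * sin r) \<longlongrightarrow> 0) (at_right 0)"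
    by (auto intro!: tendsto_eq_intros)
  then have "\<forall>\<^sub>F r in at_right 0. sqrt 2 * sin r < e"
    using e by (auto simp: order_tendsto_iff)
  moreover have "\<forall>\<^sub>F r in at_right 0. 0 < r \<and> r < pi / 2"
    using eventually_at_right_real[of 0 "pi/2"] by simp
  ultimately have "\<exists>r. sqrt 2 * sin r < e \<and> 0 < r \<and> r < pi / 2"
    using eventually_happens[of _ "at_right (0::real)"] eventually_conj by (metis (mono_tags, lifting) trivial_limit_at_right_real)
  then obtain r where r: "sqrt 2 * sin r < e" "0 < r" "r < pi / 2"
    by blast
  have "ball_of S \<theta> y r \<subseteq> chordal_ball x R"
  proof
    fix z assume "z \<in> ball_of S \<theta> y r"
    then have z: "z \<in> S" "chord y z < e"
      using r e ball_of_eq[of y r] by (auto simp: chordal_ball_def)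
    have "chord x z \<le> chord x y + chord y z"
      using norm_triangle_ineq[of "\<phi> x - \<phi> y" "\<phi> y - \<phi> z"] by simp
    then show "z \<in> chordal_ball x R"
      using z by (simp add: chordal_ball_def e_def)
  qed
  then show "\<exists>r>0. ball_of S \<theta> y r \<subseteq> chordal_ball x R"
    using r by blast
qed

end

section \<open>Volumes of balls and spheres under the invariant measure\<close>

locale chordal_measure_space = chordal_space S \<theta> \<phi> D
  for S :: "'p set" and \<theta> and \<phi> :: "'p \<Rightarrow> 'e::real_inner" and D +
  fixes \<sigma> :: "'p measure"
  assumes invariant: "invariant_prob S \<theta> \<sigma>"
begin

sublocale prob_space \<sigma>
  by (rule prob_spaceI) (use invariant in \<open>simp add: invariant_prob_def\<close>)

lemma space_sigma: "space \<sigma> = S"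
  using invariant by (simp add: invariant_prob_def)

lemma chordal_ball_sets [measurable]: "chordal_ball x R \<in> sets \<sigma>"
  using invariant chordal_ball_open by (auto simp: invariant_prob_def intro: sigma_sets.Basic)

lemma chord_measurable [measurable]: "(\<lambda>y. chord x y) \<in> borel_measurable \<sigma>"
proof (rule borel_measurableI_less)
  show "{y \<in> space \<sigma>. chord x y < R} \<in> sets \<sigma>" for R
    using chordal_ball_sets[of x R] by (simp add: chordal_ball_def space_sigma)
qed

lemma measure_chord_eq:
  assumes "x \<in> S" "x' \<in> S" "{y \<in> S. P (chord x y)} \<in> sets \<sigma>"
  shows "measure \<sigma> {y \<in> S. P (chord x y)} = measure \<sigma> {y \<in> S. P (chord x' y)}"
proof -
  obtain f where f: "isometry_of S \<theta> f" "f x = x'"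
    using transitive assms by blast
  have "emeasure \<sigma> (f ` {y \<in> S. P (chord x y)}) = emeasure \<sigma> {y \<in> S. P (chord x y)}"
    using invariant f assms(3) by (auto simp: invariant_prob_def)
  then show ?thesis
    using isometry_image[OF f(1) assms(1), of P] f by (simp add: measure_def)
qed

text \<open>Integrating the number of times that k of these spheres cover a point gives
  \<open>k * s \<le> m\<close> for every k, so the common measure \<open>s\<close> vanishes.\<close>

lemma sphere_null:
  assumes "x \<in> S" "R > 0"
  shows "measure \<sigma> {y \<in> S. chord x y = R} = 0"
proof -
  obtain \<gamma> :: "nat \<Rightarrow> 'p" and m where gam: "range \<gamma> \<subseteq> S" and
    cd: "\<And>y. y \<in> S \<Longrightarrow> finite {t. chord y (\<gamma> t) = R} \<and> card {t. chord y (\<gamma> t) = R} \<le> m"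
    using general_position assms(2) by metis
  let ?A = "\<lambda>x. {y \<in> S. chord x y = R}"
  have A: "?A x \<in> sets \<sigma>" for x
  proof -
    have "{y \<in> space \<sigma>. chord x y = R} \<in> sets \<sigma>"
      by measurable
    then show ?thesis by (simp add: space_sigma)
  qed
  define s where "s = measure \<sigma> (?A x)"
  have s: "measure \<sigma> (?A (\<gamma> t)) = s" for t
    unfolding s_def using gam assms A by (intro measure_chord_eq[where P="\<lambda>c. c = R"]) auto
  have "real k * s \<le> real m" for k
  proof -
    have "real k * s = (\<Sum>t<k. \<integral>y. indicator (?A (\<gamma> t)) y \<partial>\<sigma>)"
      using s A by simp
    also have "\<dots> = (\<integral>y. (\<Sum>t<k. indicator (?A (\<gamma> t)) y) \<partial>\<sigma>)"
      using A by (intro Bochner_Integration.integral_sum[symmetric]) (auto simp: emeasure_eq_measure)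
    also have "\<dots> \<le> (\<integral>y. real m \<partial>\<sigma>)"
    proof (rule integral_mono)
      fix y assume "y \<in> space \<sigma>"
      then have y: "y \<in> S" by (simp add: space_sigma)
      \<comment> \<open>By symmetry of the chord, the spheres through y correspond to the parameters
        t that \<open>general_position\<close> counts at y.\<close>
      have "(\<Sum>t<k. indicator (?A (\<gamma> t)) y) = (\<Sum>t<k. if chord y (\<gamma> t) = R then 1 else (0::real))"
        using y by (intro sum.cong) (auto simp: indicator_def norm_minus_commute)
      also have "\<dots> = real (card ({..<k} \<inter> {t. chord y (\<gamma> t) = R}))"
        by (simp add: sum.If_cases)
      also have "\<dots> \<le> real (card {t. chord y (\<gamma> t) = R})"
        using cd[OF y] by (auto intro!: card_mono)
      finally show "(\<Sum>t<k. indicator (?A (\<gamma> t)) y) \<le> real m"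
        using cd[OF y] by linarith
    qed (use A in \<open>auto simp: emeasure_eq_measure\<close>)
    finally show ?thesis
      by (simp add: prob_space)
  qed
  then have "s \<le> 0"
    by (metis (no_types, opaque_lifting) linorder_not_less mult.commute reals_Archimedean3)
  then show ?thesis
    using measure_nonneg[of \<sigma> "?A x"] by (simp add: s_def)
qed

text \<open>The volume is essentially the distribution function of \<open>chord x\<close>, whose
  atoms are the spheres. The function \<open>cdf\<close> counts closed balls; at positive radii
  these differ from the open ones by a null sphere, so the two functions agree near
  \<open>R\<close>.\<close>

lemma chordal_ball_measure_isCont:
  assumes "x \<in> S" "R > 0"
  shows "isCont (\<lambda>R. measure \<sigma> (chordal_ball x R)) R"
proof -
  let ?M = "distr \<sigma> borel (chord x)"
  interpret M: prob_space ?M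
    by (rule prob_space_distr) simp
  interpret M: finite_borel_measure ?M
    by unfold_locales auto
  have eq: "cdf ?M r = measure \<sigma> (chordal_ball x r)" if "r > 0" for r
  proof -
    have "cdf ?M r = measure \<sigma> {y \<in> S. chord x y \<le> r}"
      by (simp add: cdf_def measure_distr vimage_def space_sigma Int_def conj_commute)
    also have "{y \<in> S. chord x y \<le> r} = chordal_ball x r \<union> {y \<in> S. chord x y = r}"
      by (auto simp: chordal_ball_def)
    also have "measure \<sigma> \<dots> = measure \<sigma> (chordal_ball x r)"
    proof (rule measure_Un_null_set)
      have "{y \<in> space \<sigma>. chord x y = r} \<in> sets \<sigma>"
        by measurable
      then show "{y \<in> S. chord x y = r} \<in> null_sets \<sigma>"
        using sphere_null[OF assms(1) that] by (auto simp: space_sigma null_sets_def emeasure_eq_measure)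
    qed simp
    finally show ?thesis .
  qed
  have "measure ?M {R} = measure \<sigma> {y \<in> S. chord x y = R}"
    by (simp add: measure_distr vimage_def space_sigma Int_def conj_commute)
  then have "isCont (cdf ?M) R"
    using sphere_null[OF assms] by (simp add: M.isCont_cdf)
  moreover have "\<forall>\<^sub>F r in nhds R. cdf ?M r = measure \<sigma> (chordal_ball x r)"
    using eventually_nhds_in_open[of "{0<..}" R] assms(2) by (auto elim!: eventually_mono simp: eq)
  ultimately show ?thesis
    by (simp add: isCont_cong)
qed

lemma measure_chordal_ball_eq: "x \<in> S \<Longrightarrow> y \<in> S \<Longrightarrow> measure \<sigma> (chordal_ball x R) = measure \<sigma> (chordal_ball y R)"
  unfolding chordal_ball_def
  using chordal_ball_sets[of x R] by (intro measure_chord_eq[where P="\<lambda>c. c < R"]) (auto simp: chordal_ball_def)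

lemma chordal_ball_measure_lower_bound:
  "\<exists>c>0. \<forall>x\<in>S. \<forall>R. 0 < R \<longrightarrow> R \<le> 1 \<longrightarrow> c * R ^ D \<le> measure \<sigma> (chordal_ball x R)"
proof -
  obtain K where K: "\<And>\<rho>. 0 < \<rho> \<Longrightarrow> \<rho> \<le> 1 \<Longrightarrow>
      \<exists>T\<subseteq>S. finite T \<and> real (card T) * \<rho> ^ D \<le> K \<and> (\<forall>x\<in>S. \<exists>y\<in>T. chord x y < \<rho>)"
    using cover by blast
  define c where "c = 1 / (\<bar>K\<bar> + 1)"
  have "c * R ^ D \<le> measure \<sigma> (chordal_ball x R)" if x: "x \<in> S" and R: "0 < R" "R \<le> 1" for x R
  proof -
    obtain T where T: "T \<subseteq> S" "finite T" "real (card T) * R ^ D \<le> K" "\<forall>x\<in>S. \<exists>y\<in>T. chord x y < R"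
      using K[OF R] by blast
    let ?b = "measure \<sigma> (chordal_ball x R)"
    have "1 = measure \<sigma> (\<Union>y\<in>T. chordal_ball y R)"
    proof -
      have "(\<Union>y\<in>T. chordal_ball y R) = S"
        using T by (auto simp: chordal_ball_def norm_minus_commute)
      then show ?thesis
        using prob_space by (simp add: space_sigma)
    qed
    also have "\<dots> \<le> (\<Sum>y\<in>T. measure \<sigma> (chordal_ball y R))"
      using T by (intro finite_measure_subadditive_finite) auto
    also have "\<dots> = (\<Sum>y\<in>T. ?b)"
      using T x by (intro sum.cong measure_chordal_ball_eq) auto
    finally have "1 \<le> real (card T) * ?b" by simp
    then have "R ^ D \<le> (real (card T) * R ^ D) * ?b"
      using R mult_left_mono[of 1 "real (card T) * ?b" "R ^ D"] by (simp add: ac_simps)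
    \<comment> \<open>Passing from \<open>K\<close> to \<open>\<bar>K\<bar> + 1\<close> makes the
      constant \<open>c\<close> well defined and positive whatever the sign of
      \<open>K\<close>.\<close>
    also have "\<dots> \<le> (\<bar>K\<bar> + 1) * ?b"
      using T by (intro mult_right_mono) auto
    finally show ?thesis
      by (simp add: c_def field_simps)
  qed
  moreover have "c > 0" by (simp add: c_def add_nonneg_pos)
  ultimately show ?thesis by blast
qed

section \<open>From number variance to counting points in a fixed ball\<close>

text \<open>Let g be the discrepancy times the indicator of \<open>A\<close>. Nonnegativity of the
  variance of g gives (E g)^2 <= E g^2, and dropping the indicator from the square only increases
  the right side. Since x lies in the ball about y exactly when y lies in the ball about x, the mean
  of g is the expression between the bars.\<close>

lemma averaged_discrepancy:
  assumes X: "finite X" "X \<subseteq> S" and A: "A \<in> sets \<sigma>" and r: "0 \<le> r" "r \<le> pi / 2" and x0: "x0 \<in> S"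
  defines "\<rho> \<equiv> sqrt 2 * sin r"
  shows "\<bar>(\<Sum>y\<in>X. measure \<sigma> (A \<inter> chordal_ball y \<rho>)) - real (card X) * measure \<sigma> (chordal_ball x0 \<rho>) * measure \<sigma> A\<bar>
    \<le> sqrt (number_variance S \<theta> \<sigma> X r)"
proof -
  let ?b = "measure \<sigma> (chordal_ball x0 \<rho>)"
  define f where "f x = (\<Sum>y\<in>X. indicator (chordal_ball y \<rho>) x) - real (card X) * ?b" for x
  have [measurable]: "f \<in> borel_measurable \<sigma>"
    unfolding f_def by measurable
  have bd: "\<bar>f x\<bar> \<le> 2 * real (card X)" for x
  proof -
    have "(\<Sum>y\<in>X. indicator (chordal_ball y \<rho>) x) \<le> (\<Sum>y\<in>X. 1::real)"
      by (intro sum_mono) (auto simp: indicator_def)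
    moreover have "0 \<le> (\<Sum>y\<in>X. indicator (chordal_ball y \<rho>) x :: real)"
      by (intro sum_nonneg) auto
    moreover have "real (card X) * ?b \<le> real (card X) * 1"
      by (intro mult_left_mono) auto
    moreover have "0 \<le> real (card X) * ?b" by simp
    ultimately show ?thesis unfolding f_def abs_le_iff sum_constant by linarith
  qed
  define g where "g x = indicator A x * f x" for x
  have [measurable]: "g \<in> borel_measurable \<sigma>"
    unfolding g_def using A by measurable
  have gb: "\<bar>g x\<bar> \<le> 2 * real (card X)" for x
    using bd[of x] by (auto simp: g_def indicator_def)
  have sq: "u\<^sup>2 \<le> (2 * real (card X))\<^sup>2" if "\<bar>u\<bar> \<le> 2 * real (card X)" for u :: real
    using that power_mono[OF that abs_ge_zero, of 2] by simp
  have ig: "integrable \<sigma> g"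
    by (rule integrable_const_bound[where B="2 * real (card X)"]) (auto simp: gb)
  have ig2: "integrable \<sigma> (\<lambda>x. (g x)\<^sup>2)"
    by (rule integrable_const_bound[where B="(2 * real (card X))\<^sup>2"], rule AE_I2)
      (simp only: real_norm_def abs_power2 sq[OF gb], measurable)
  have if2: "integrable \<sigma> (\<lambda>x. (f x)\<^sup>2)"
    by (rule integrable_const_bound[where B="(2 * real (card X))\<^sup>2"], rule AE_I2)
      (simp only: real_norm_def abs_power2 sq[OF bd], measurable)
  have "(\<integral>x. g x \<partial>\<sigma>) = (\<integral>x. (\<Sum>y\<in>X. indicator (A \<inter> chordal_ball y \<rho>) x) - real (card X) * ?b * indicator A x \<partial>\<sigma>)"
    by (intro Bochner_Integration.integral_cong)
      (auto simp: g_def f_def indicator_def sum_distrib_left algebra_simps intro!: sum.cong)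
  also have "\<dots> = (\<Sum>y\<in>X. measure \<sigma> (A \<inter> chordal_ball y \<rho>)) - real (card X) * ?b * measure \<sigma> A"
    using A by (subst Bochner_Integration.integral_diff)
      (auto simp: emeasure_eq_measure Bochner_Integration.integral_sum)
  finally have mean: "(\<integral>x. g x \<partial>\<sigma>) = \<dots>" .
  have "(\<integral>x. g x \<partial>\<sigma>)\<^sup>2 \<le> (\<integral>x. (g x)\<^sup>2 \<partial>\<sigma>)"
    using variance_positive[of g] variance_eq[OF ig ig2] by simp
  also have "\<dots> \<le> (\<integral>x. (f x)\<^sup>2 \<partial>\<sigma>)"
    by (intro integral_mono ig2 if2) (auto simp: g_def indicator_def)
  also have "\<dots> = number_variance S \<theta> \<sigma> X r"
    unfolding number_variance_def
  proof (intro Bochner_Integration.integral_cong refl)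
    fix x assume "x \<in> space \<sigma>"
    then have x: "x \<in> S" by (simp add: space_sigma)
    have "indicator (ball_of S \<theta> x r) y = (indicator (chordal_ball y \<rho>) x :: real)" if "y \<in> X" for y
      using that X x r by (auto simp: ball_of_eq chordal_ball_def \<rho>_def norm_minus_commute indicator_def)
    moreover have "measure \<sigma> (ball_of S \<theta> x r) = ?b"
      using x r x0 by (simp add: ball_of_eq \<rho>_def measure_chordal_ball_eq[of x x0])
    ultimately show "(f x)\<^sup>2 = ((\<Sum>y\<in>X. indicator (ball_of S \<theta> x r) y)
            - real (card X) * measure \<sigma> (ball_of S \<theta> x r))\<^sup>2"
      by (simp add: f_def)
  qed
  finally show ?thesis
    unfolding mean by (metis real_sqrt_abs real_sqrt_le_mono)
qed

text \<open>A point of the ball of radius \<open>R\<close> has its whole \<open>\<rho>\<close>-ball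
  inside radius \<open>R + \<rho>\<close> and so contributes the full \<open>b\<close> there; a
  point outside has a \<open>\<rho>\<close>-ball disjoint from the ball of radius
  \<open>R - \<rho>\<close> and contributes nothing.\<close>

lemma count_bounds:
  assumes X: "finite X" "X \<subseteq> S" and x0: "x0 \<in> S" and r: "0 \<le> r" "r \<le> pi / 2"
  defines "\<rho> \<equiv> sqrt 2 * sin r"
  defines "b \<equiv> measure \<sigma> (chordal_ball x0 \<rho>)"
  shows "b * real (card (X \<inter> chordal_ball x0 R))
      \<le> real (card X) * b * measure \<sigma> (chordal_ball x0 (R + \<rho>)) + sqrt (number_variance S \<theta> \<sigma> X r)"
    and "real (card X) * b * measure \<sigma> (chordal_ball x0 (R - \<rho>)) - sqrt (number_variance S \<theta> \<sigma> X r)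
      \<le> b * real (card (X \<inter> chordal_ball x0 R))"
proof -
  have tri: "chord x z \<le> chord x y + chord y z" for x y z
    using norm_triangle_ineq[of "\<phi> x - \<phi> y" "\<phi> y - \<phi> z"] by simp
  have eqb: "measure \<sigma> (chordal_ball y \<rho>) = b" if "y \<in> X" for y
    using that X x0 by (auto simp: b_def intro: measure_chordal_ball_eq)
  have cd: "b * real (card (X \<inter> chordal_ball x0 R)) = (\<Sum>y\<in>X. if y \<in> chordal_ball x0 R then b else 0)"
    using X by (simp add: sum.If_cases)
  note av = averaged_discrepancy[OF X chordal_ball_sets r x0, folded \<rho>_def, folded b_def]
  have "b * real (card (X \<inter> chordal_ball x0 R))
      \<le> (\<Sum>y\<in>X. measure \<sigma> (chordal_ball x0 (R + \<rho>) \<inter> chordal_ball y \<rho>))"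
    unfolding cd
  proof (rule sum_mono)
    fix y assume y: "y \<in> X"
    show "(if y \<in> chordal_ball x0 R then b else 0) \<le> measure \<sigma> (chordal_ball x0 (R + \<rho>) \<inter> chordal_ball y \<rho>)"
    proof (cases "y \<in> chordal_ball x0 R")
      case True
      have "chordal_ball y \<rho> \<subseteq> chordal_ball x0 (R + \<rho>)"
      proof
        fix z assume "z \<in> chordal_ball y \<rho>"
        then show "z \<in> chordal_ball x0 (R + \<rho>)"
          using True tri[of x0 z y] by (auto simp: chordal_ball_def)
      qed
      then show ?thesis
        using eqb[OF y] True by (simp add: Int_absorb1)
    qed simp
  qed
  then show "b * real (card (X \<inter> chordal_ball x0 R))
      \<le> real (card X) * b * measure \<sigma> (chordal_ball x0 (R + \<rho>)) + sqrt (number_variance S \<theta> \<sigma> X r)"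
    using av[of x0 "R + \<rho>"] by linarith
  have "(\<Sum>y\<in>X. measure \<sigma> (chordal_ball x0 (R - \<rho>) \<inter> chordal_ball y \<rho>)) \<le> b * real (card (X \<inter> chordal_ball x0 R))"
    unfolding cd
  proof (rule sum_mono)
    fix y assume y: "y \<in> X"
    show "measure \<sigma> (chordal_ball x0 (R - \<rho>) \<inter> chordal_ball y \<rho>) \<le> (if y \<in> chordal_ball x0 R then b else 0)"
    proof (cases "y \<in> chordal_ball x0 R")
      case True
      then show ?thesis
        using eqb[OF y] by (auto intro!: finite_measure_mono)
    next
      case False
      have "chordal_ball x0 (R - \<rho>) \<inter> chordal_ball y \<rho> = {}"
      proof (intro equals0I)
        fix z assume "z \<in> chordal_ball x0 (R - \<rho>) \<inter> chordal_ball y \<rho>"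
        then have "chord x0 z < R - \<rho>" "chord y z < \<rho>"
          by (auto simp: chordal_ball_def)
        then have "y \<in> chordal_ball x0 R"
          using tri[of x0 y z] X y norm_minus_commute[of "\<phi> y" "\<phi> z"] by (auto simp: chordal_ball_def)
        then show False using False by simp
      qed
      then show ?thesis using False by simp
    qed
  qed
  then show "real (card X) * b * measure \<sigma> (chordal_ball x0 (R - \<rho>)) - sqrt (number_variance S \<theta> \<sigma> X r)
      \<le> b * real (card (X \<inter> chordal_ball x0 R))"
    using av[of x0 "R - \<rho>"] by linarith
qed

theorem hyperuniform_imp_uniformly_distributed:
  assumes X: "point_sets S X" and hyp: "hyperuniform_threshold S \<theta> \<sigma> D X"
  shows "uniformly_distributed S \<theta> \<sigma> X"
  unfolding uniformly_distributed_def
proof (intro ballI)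
  fix x0 r assume x0: "x0 \<in> S" and r: "r \<in> {0..pi / 2}"
  have fin: "finite (X N)" "X N \<subseteq> S" for N
    using X by (auto simp: point_sets_def)
  have Xinf: "filterlim (\<lambda>N. real (card (X N))) at_top sequentially"
    using X by (auto simp: point_sets_def intro: filterlim_compose[OF filterlim_real_sequentially])
  define R where "R = sqrt 2 * sin r"
  define G where "G R = measure \<sigma> (chordal_ball x0 R)" for R
  have ball: "ball_of S \<theta> x0 r = chordal_ball x0 R"
    using x0 r by (simp add: ball_of_eq R_def)
  have sum_eq: "(\<Sum>y\<in>X N. indicator (ball_of S \<theta> x0 r) y) = real (card (X N \<inter> chordal_ball x0 R))" for N
    using sum.inter_restrict[OF fin(1), of "\<lambda>_. 1::real" N "chordal_ball x0 R"] by (simp add: ball indicator_def of_bool_def)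
  show "(\<lambda>N. 1 / real (card (X N)) * (\<Sum>y\<in>X N. indicator (ball_of S \<theta> x0 r) y))
          \<longlonglongrightarrow> measure \<sigma> (ball_of S \<theta> x0 r)"
  \<comment> \<open>Continuity of the volume is available at positive radii only; for radius 0 the
    open ball is empty and both sides are 0.\<close>
  proof (cases "r = 0")
    case True
    then have "chordal_ball x0 R = {}"
      by (auto simp: chordal_ball_def R_def)
    then show ?thesis
      by (simp add: sum_eq ball)
  next
    case False
    then have "sin r > 0"
      using r pi_gt_zero unfolding atLeastAtMost_iff by (intro sin_gt_zero) linarith+
    then have R: "R > 0" by (simp add: R_def)
    show ?thesis
      unfolding sum_eq unfolding ball
    proof (rule LIMSEQ_I)
      fix e :: real assume e: "0 < e"
      obtain \<eta> where eta: "\<eta> > 0" "\<And>R'. \<bar>R' - R\<bar> < \<eta> \<Longrightarrow> \<bar>G R' - G R\<bar> < e / 2"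
        using chordal_ball_measure_isCont[OF x0 R] e unfolding G_def isCont_def LIM_def dist_real_def
        by (metis abs_0 diff_self half_gt_zero)
      obtain c where c: "c > 0" "\<And>R. 0 < R \<Longrightarrow> R \<le> 1 \<Longrightarrow> c * R ^ D \<le> G R"
        using chordal_ball_measure_lower_bound x0 unfolding G_def by blast
      obtain C where C: "\<forall>\<^sub>F r in at_top.
        limsup (\<lambda>N. ereal (number_variance S \<theta> \<sigma> (X N) (r * real (card (X N)) powr (- 1 / real D))))
          \<le> ereal (C * r ^ (D - 1))"
        using hyp by (auto simp: hyperuniform_threshold_def)
      \<comment> \<open>The chordal radius of a small angle t is at least t / 2; the power of 2 pays
        for that replacement in the lower volume bound.\<close>
      define c' where "c' = c / 2 ^ D"
      have c': "c' > 0" using c by (simp add: c'_def)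
      \<comment> \<open>This quotient will dominate the error \<open>sqrt V / (n * b)\<close>. The
        summand 1 is the slack that turns the bound on the limsup into a strict bound for all large
        N.\<close>
      have "((\<lambda>s. sqrt (\<bar>C\<bar> * s ^ (D - 1) + 1) / (c' * s ^ D)) \<longlongrightarrow> 0) at_top"
      proof (rule tendsto_sandwich[of "\<lambda>_. 0"])
        have "sqrt (\<bar>C\<bar> * s ^ (D - 1) + 1) / (c' * s ^ D) \<le> (\<bar>C\<bar> + 1) / (c' * s)" if s: "s \<ge> 1" for s
        proof -
          have p: "1 \<le> s ^ (D - 1)" using s by simp
          have "\<bar>C\<bar> * s ^ (D - 1) + 1 \<le> (\<bar>C\<bar> + 1) * s ^ (D - 1)"
            using p by (simp add: algebra_simps)
          \<comment> \<open>A number z >= 1 satisfies z <= z^2, so the root is at most z itself, and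
            the quotient decays like 1 / s.\<close>
          also have "\<dots> \<le> ((\<bar>C\<bar> + 1) * s ^ (D - 1))\<^sup>2"
          proof -
            have "1 * 1 \<le> (\<bar>C\<bar> + 1) * s ^ (D - 1)"
              using p by (intro mult_mono) auto
            then show ?thesis
              using self_le_power[of "(\<bar>C\<bar> + 1) * s ^ (D - 1)" 2] by simp
          qed
          finally have "sqrt (\<bar>C\<bar> * s ^ (D - 1) + 1) \<le> (\<bar>C\<bar> + 1) * s ^ (D - 1)"
            using p by (intro real_le_lsqrt) auto
          then have "sqrt (\<bar>C\<bar> * s ^ (D - 1) + 1) / (c' * s ^ D) \<le> (\<bar>C\<bar> + 1) * s ^ (D - 1) / (c' * s ^ D)"
            using s c' by (intro divide_right_mono) auto
          also have "\<dots> = (\<bar>C\<bar> + 1) / (c' * s)"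
            using s D_pos by (cases D) auto
          finally show ?thesis .
        qed
        then show "\<forall>\<^sub>F s in at_top. sqrt (\<bar>C\<bar> * s ^ (D - 1) + 1) / (c' * s ^ D) \<le> (\<bar>C\<bar> + 1) / (c' * s)"
          by (rule eventually_mono[OF eventually_ge_at_top[of 1]])
        show "\<forall>\<^sub>F s in at_top. 0 \<le> sqrt (\<bar>C\<bar> * s ^ (D - 1) + 1) / (c' * s ^ D)"
          using eventually_ge_at_top[of 1] by eventually_elim (use c' in auto)
        show "((\<lambda>s. (\<bar>C\<bar> + 1) / (c' * s)) \<longlongrightarrow> 0) at_top"
          using c' by real_asymp
      qed simp
      then have "\<forall>\<^sub>F s in at_top. sqrt (\<bar>C\<bar> * s ^ (D - 1) + 1) / (c' * s ^ D) < e / 2"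
        by (rule order_tendstoD(2)) (use e in simp)
      then have "\<forall>\<^sub>F s in at_top. sqrt (\<bar>C\<bar> * s ^ (D - 1) + 1) / (c' * s ^ D) < e / 2 \<and> s \<ge> 1 \<and>
         limsup (\<lambda>N. ereal (number_variance S \<theta> \<sigma> (X N) (s * real (card (X N)) powr (- 1 / real D))))
          \<le> ereal (C * s ^ (D - 1))"
        using C eventually_ge_at_top[of 1] by eventually_elim auto
      \<comment> \<open>The scale s is fixed here, with the error already below e / 2; only
        afterwards does N grow, matching the order of the two limits in the hypothesis.\<close>
      from eventually_happens'[OF trivial_limit_at_top_linorder this]
      obtain s where s: "sqrt (\<bar>C\<bar> * s ^ (D - 1) + 1) / (c' * s ^ D) < e / 2" "s \<ge> 1" and
         ls: "limsup (\<lambda>N. ereal (number_variance S \<theta> \<sigma> (X N) (s * real (card (X N)) powr (- 1 / real D))))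
          \<le> ereal (C * s ^ (D - 1))"
        by blast
      let ?t = "\<lambda>N. s * real (card (X N)) powr (- 1 / real D)"
      let ?V = "\<lambda>N. number_variance S \<theta> \<sigma> (X N) (?t N)"
      have "\<bar>C\<bar> * s ^ (D - 1) + 1 > C * s ^ (D - 1)"
        using s abs_ge_self[of C] by (smt (verit) mult_right_mono zero_le_power)
      then have "limsup (\<lambda>N. ereal (?V N)) < ereal (\<bar>C\<bar> * s ^ (D - 1) + 1)"
        using ls by (meson ereal_less_eq(3) le_less_trans less_ereal.simps(1))
      then have V: "\<forall>\<^sub>F N in sequentially. ?V N < \<bar>C\<bar> * s ^ (D - 1) + 1"
        by (auto dest: Limsup_lessD)
      have t0: "filterlim ?t (at_right 0) sequentially"
      proof (rule filterlim_compose[OF _ Xinf])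
        show "filterlim (\<lambda>n. s * n powr (- 1 / real D)) (at_right 0) at_top"
          using s D_pos by real_asymp
      qed
      have "\<forall>\<^sub>F t in at_right 0. t / 2 \<le> sqrt 2 * sin t \<and> sqrt 2 * sin t < \<eta> \<and> sqrt 2 * sin t \<le> 1
          \<and> 0 < t \<and> t \<le> pi / 2"
      proof (intro eventually_conj)
        have "\<forall>\<^sub>F t in at_right 0. t / 2 < sin (t::real)"
          by real_asymp
        then show "\<forall>\<^sub>F t in at_right 0. t / 2 \<le> sqrt 2 * sin (t::real)"
          using eventually_at_right_less
        proof eventually_elim
          case (elim t)
          have "1 * sin t \<le> sqrt 2 * sin t"
            using elim by (intro mult_right_mono) auto
          then show ?case using elim by linarith
        qed
        have lim: "((\<lambda>r. sqrt 2 * sin r) \<longlongrightarrow> 0) (at_right 0)"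
          by (auto intro!: tendsto_eq_intros)
        show "\<forall>\<^sub>F t in at_right 0. sqrt 2 * sin t < \<eta>"
          using lim eta by (auto simp: order_tendsto_iff)
        have "\<forall>\<^sub>F t in at_right 0. sqrt 2 * sin t < (1::real)"
          using lim by (auto simp: order_tendsto_iff)
        then show "\<forall>\<^sub>F t in at_right 0. sqrt 2 * sin t \<le> (1::real)"
          by (rule eventually_mono) simp
        show "\<forall>\<^sub>F t in at_right 0. 0 < (t::real)"
          by (simp add: eventually_at_right_less)
        show "\<forall>\<^sub>F t in at_right 0. t \<le> pi / 2"
          using eventually_at_right_real[of 0 "pi/2"] by (auto elim: eventually_mono)
      qed
      then have "\<forall>\<^sub>F N in sequentially. ?t N / 2 \<le> sqrt 2 * sin (?t N) \<and> sqrt 2 * sin (?t N) < \<eta>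
          \<and> sqrt 2 * sin (?t N) \<le> 1 \<and> 0 < ?t N \<and> ?t N \<le> pi / 2"
        using t0 unfolding filterlim_iff by blast
      moreover have "\<forall>\<^sub>F N in sequentially. 1 \<le> real (card (X N))"
        using Xinf unfolding filterlim_at_top by blast
      ultimately have "\<forall>\<^sub>F N in sequentially.
          norm (1 / real (card (X N)) * real (card (X N \<inter> chordal_ball x0 R)) - G R) < e"
        using V
      proof eventually_elim
        case (elim N)
        define n where "n = real (card (X N))"
        define t where "t = ?t N"
        define \<rho> where "\<rho> = sqrt 2 * sin t"
        have n: "n \<ge> 1" and t: "0 < t" "t \<le> pi / 2" "t / 2 \<le> \<rho>" "\<rho> < \<eta>" "\<rho> \<le> 1"
          using elim by (auto simp: n_def t_def \<rho>_def)
        have rho: "\<rho> > 0" using t by linarith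
        have Vn: "number_variance S \<theta> \<sigma> (X N) t < \<bar>C\<bar> * s ^ (D - 1) + 1"
          using elim by (simp add: t_def)
        let ?W = "sqrt (number_variance S \<theta> \<sigma> (X N) t)"
        define b where "b = G \<rho>"
        \<comment> \<open>The threshold scaling makes n * t^D equal to s^D, so the expected number
          of points \<open>n * b\<close> in a test ball is bounded below independently of N.\<close>
        have "(n powr (- 1 / real D)) ^ D = n powr (- 1 / real D * real D)"
          using n by (simp add: powr_realpow[symmetric] powr_powr)
        also have "\<dots> = 1 / n"
          using D_pos n by (simp add: powr_minus_divide)
        finally have "t ^ D = s ^ D / n"
          unfolding t_def n_def[symmetric] power_mult_distrib by simp
        then have "c' * s ^ D = n * (c * (t / 2) ^ D)"
          using n by (simp add: c'_def power_divide field_simps)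
        also have "\<dots> \<le> n * (c * \<rho> ^ D)"
          using n c t by (intro mult_left_mono power_mono) auto
        also have "\<dots> \<le> n * b"
          using n c(2)[of \<rho>] rho t by (intro mult_left_mono) (auto simp: b_def)
        finally have nb: "c' * s ^ D \<le> n * b" .
        have pos: "0 < c' * s ^ D"
          using c' s by simp
        then have "b > 0"
          using nb n by (metis less_le_trans less_numeral_extra(1) zero_less_mult_pos)
        have Wn: "?W / (n * b) < e / 2"
        proof -
          have "0 \<le> number_variance S \<theta> \<sigma> (X N) t"
            by (simp add: number_variance_def)
          have "?W / (n * b) \<le> sqrt (\<bar>C\<bar> * s ^ (D - 1) + 1) / (c' * s ^ D)"
            using Vn nb pos s by (intro frac_le) auto
          then show ?thesis using s by linarith
        qed
        let ?k = "real (card (X N \<inter> chordal_ball x0 R))"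
        have up: "b * ?k \<le> n * b * G (R + \<rho>) + ?W" and lo: "n * b * G (R - \<rho>) - ?W \<le> b * ?k"
          using count_bounds[OF fin x0, of t N R] t unfolding b_def G_def n_def \<rho>_def by auto
        have "?k / n \<le> G (R + \<rho>) + ?W / (n * b)"
          using up \<open>b > 0\<close> n by (simp add: field_simps)
        moreover have "G (R - \<rho>) - ?W / (n * b) \<le> ?k / n"
        proof -
          have "(n * b * G (R - \<rho>) - ?W) / (n * b) \<le> (b * ?k) / (n * b)"
            using lo \<open>b > 0\<close> n by (intro divide_right_mono) auto
          then show ?thesis
            using \<open>b > 0\<close> n by (simp add: diff_divide_distrib)
        qed
        moreover have "\<bar>G (R + \<rho>) - G R\<bar> < e / 2" "\<bar>G (R - \<rho>) - G R\<bar> < e / 2"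
          using eta(2)[of "R + \<rho>"] eta(2)[of "R - \<rho>"] t rho by auto
        ultimately have "\<bar>?k / n - G R\<bar> < e"
          using Wn by linarith
        then show ?case by (simp add: n_def)
      qed
      then show "\<exists>no. \<forall>n\<ge>no. norm (1 / real (card (X n)) * real (card (X n \<inter> chordal_ball x0 R)) - measure \<sigma> (chordal_ball x0 R)) < e"
        by (simp add: eventually_sequentially G_def)
    qed
  qed
qed

end

section \<open>Points on a curve in general position with respect to quadratic forms\<close>

text \<open>The larger exponent is determined by the sum: if b < b', then 2^a + 2^b <= 2^(b+1) <=
  2^b', which is less than any sum containing 2^b'.\<close>

lemma two_power_add_eq:
  fixes j k :: nat
  assumes "(2::nat) ^ j + 2 ^ k = 2 ^ j' + 2 ^ k'"
  shows "(j = j' \<and> k = k') \<or> (j = k' \<and> k = j')"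
proof -
  have lt: False if "a \<le> b" "a' \<le> b'" "b < b'" "(2::nat) ^ a + 2 ^ b = 2 ^ a' + 2 ^ b'" for a b a' b' :: nat
  proof -
    have "(2::nat) ^ a \<le> 2 ^ b" "(2::nat) ^ Suc b \<le> 2 ^ b'" "(0::nat) < 2 ^ a'"
      using that by (auto intro: power_increasing simp del: power_Suc)
    then show False using that(4) unfolding power_Suc by linarith
  qed
  have *: "a = a' \<and> b = b'" if "a \<le> b" "a' \<le> b'" "(2::nat) ^ a + 2 ^ b = 2 ^ a' + 2 ^ b'" for a b a' b' :: nat
  proof -
    have "b = b'"
      using lt[of a b a' b'] lt[of a' b' a b] that by (metis nat_neq_iff)
    then show ?thesis using that by simp
  qed
  show ?thesis
    using *[of j k j' k'] *[of j k k' j'] *[of k j j' k'] *[of k j k' j'] assms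
    by (metis add.commute nat_le_linear)
qed

text \<open>
  The exponents \<open>2\<^sup>k - 1\<close> have distinct pairwise sums, so a quadratic form along the curve is a
  polynomial whose coefficients are those of the form.
\<close>

definition sidon_curve :: "(nat \<Rightarrow> 'v::real_vector) \<Rightarrow> nat \<Rightarrow> nat \<Rightarrow> 'v" where
  "sidon_curve v M t = (\<Sum>k<M. (real t ^ (2 ^ k - 1)) *\<^sub>R v k)"

text \<open>If the polynomial vanished, each of its coefficients would force the symmetrisation of
  \<open>B\<close> to vanish on a pair of generators, hence on their whole span, against
  \<open>B w w \<noteq> 0\<close>. A nonzero polynomial has at most as many roots as its degree,
  which \<open>2 ^ (M + 1)\<close> bounds for every form and every curve with \<open>M\<close>
  generators.\<close>

lemma sidon_curve_zeros:
  fixes B :: "'v::real_vector \<Rightarrow> 'v \<Rightarrow> real"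
  assumes B: "bilinear B" and w: "w \<in> span (v ` {..<M})" "B w w \<noteq> 0"
  shows "finite {t. B (sidon_curve v M t) (sidon_curve v M t) = 0}"
    and "card {t. B (sidon_curve v M t) (sidon_curve v M t) = 0} \<le> 2 ^ (M + 1)"
proof -
  define p where "p = (\<Sum>j<M. \<Sum>k<M. monom (B (v j) (v k)) (2 ^ j + 2 ^ k - 2))"
  have ex: "(2::nat) ^ j - 1 + (2 ^ k - 1) = 2 ^ j + 2 ^ k - 2" for j k
    using one_le_power[of "2::nat" j] one_le_power[of "2::nat" k] by linarith
  have pt: "poly p (real t) = B (sidon_curve v M t) (sidon_curve v M t)" for t
  proof -
    have "poly p (real t) = (\<Sum>j<M. \<Sum>k<M. B (v j) (v k) * real t ^ ((2 ^ j - 1) + (2 ^ k - 1)))"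
      unfolding p_def ex by (simp add: poly_sum poly_monom)
    also have "\<dots> = B (sidon_curve v M t) (sidon_curve v M t)"
      unfolding sidon_curve_def bilinear_sum[OF B] sum.cartesian_product
      by (intro sum.cong refl, clarify)
        (simp only: bilinear_lmul[OF B] bilinear_rmul[OF B] power_add real_scaleR_def mult_ac)
    finally show ?thesis .
  qed
  have "p \<noteq> 0"
  proof
    assume "p = 0"
    have sym: "B (v j) (v k) + B (v k) (v j) = 0" if jk: "j < M" "k < M" for j k
    proof -
      have "0 = coeff p (2 ^ j + 2 ^ k - 2)"
        using \<open>p = 0\<close> by simp
      also have "\<dots> = (\<Sum>(j', k') \<in> {..<M} \<times> {..<M}.
          if 2 ^ j' + 2 ^ k' - 2 = (2 ^ j + 2 ^ k - 2 :: nat) then B (v j') (v k') else 0)"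
        unfolding p_def sum.cartesian_product by (simp add: coeff_sum case_prod_unfold)
      also have "\<dots> = (\<Sum>(j', k') \<in> {..<M} \<times> {..<M}.
          if (j', k') \<in> {(j, k), (k, j)} then B (v j') (v k') else 0)"
      proof (intro sum.cong refl, clarify)
        fix j' k'
        have "2 ^ j' + 2 ^ k' - 2 = (2 ^ j + 2 ^ k - 2 :: nat) \<longleftrightarrow> 2 ^ j' + 2 ^ k' = (2 ^ j + 2 ^ k :: nat)"
          using one_le_power[of "2::nat" j] one_le_power[of "2::nat" k]
            one_le_power[of "2::nat" j'] one_le_power[of "2::nat" k'] by linarith
        also have "\<dots> \<longleftrightarrow> (j', k') \<in> {(j, k), (k, j)}"
          using two_power_add_eq[of j' k' j k] by auto
        finally show "(if 2 ^ j' + 2 ^ k' - 2 = (2 ^ j + 2 ^ k - 2 :: nat) then B (v j') (v k') else 0) =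
           (if (j', k') \<in> {(j, k), (k, j)} then B (v j') (v k') else 0)"
          by simp
      qed
      also have "\<dots> = (\<Sum>(j', k') \<in> {(j, k), (k, j)}. B (v j') (v k'))"
        by (rule sum.mono_neutral_cong_right) (use jk in \<open>auto split: if_splits\<close>)
      \<comment> \<open>When \<open>j = k\<close> the index set collapses to one pair, and the sum
        is a single \<open>B (v j) (v j)\<close> instead of two terms.\<close>
      finally show ?thesis
        by (cases "j = k") auto
    qed
    define Q where "Q x y = B x y + B y x" for x y
    have lin1: "linear (\<lambda>x. Q x y)" and lin2: "linear (\<lambda>y. Q x y)" for x y
      using B unfolding Q_def bilinear_def by (auto intro: linear_compose_add)
    have "Q (v j) w = 0" if "j < M" for j
      by (rule linear_eq_0_on_span[OF lin2 _ w(1)]) (use sym that in \<open>auto simp: Q_def\<close>)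
    then have "Q w w = 0"
      by (intro linear_eq_0_on_span[OF lin1 _ w(1)]) auto
    then show False
      using w(2) by (simp add: Q_def)
  qed
  have "degree p \<le> 2 ^ (M + 1)"
    unfolding p_def
  proof (intro degree_sum_le finite_lessThan)
    fix j k assume "j \<in> {..<M}" "k \<in> {..<M}"
    then have "(2::nat) ^ j \<le> 2 ^ M" "(2::nat) ^ k \<le> 2 ^ M"
      by (auto intro!: power_increasing simp del: power_increasing_iff)
    then have "2 ^ j + 2 ^ k - 2 \<le> (2::nat) ^ (M + 1)"
      unfolding power_add power_one_right by linarith
    then show "degree (monom (B (v j) (v k)) (2 ^ j + 2 ^ k - 2)) \<le> 2 ^ (M + 1)"
      by (rule order_trans[OF degree_monom_le])
  qed
  then have "card {x. poly p x = 0} \<le> 2 ^ (M + 1)"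
    using card_poly_roots_bound[OF \<open>p \<noteq> 0\<close>] by linarith
  moreover have fin: "finite {x. poly p x = 0}"
    by (rule poly_roots_finite[OF \<open>p \<noteq> 0\<close>])
  moreover have im: "real ` {t. B (sidon_curve v M t) (sidon_curve v M t) = 0} \<subseteq> {x. poly p x = 0}"
    by (auto simp: pt)
  ultimately show "card {t. B (sidon_curve v M t) (sidon_curve v M t) = 0} \<le> 2 ^ (M + 1)"
    using card_inj_on_le[of real "{t. B (sidon_curve v M t) (sidon_curve v M t) = 0}" "{x. poly p x = 0}"]
    by (meson inj_on_of_nat order_trans)
  show "finite {t. B (sidon_curve v M t) (sidon_curve v M t) = 0}"
    using im fin by (meson finite_imageD finite_subset inj_on_of_nat)
qed


section \<open>Rank one projections over a star algebra\<close>

text \<open>One representative is kept per key; the centres then lie in \<open>S\<close> itself,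
  which a grid of coordinates would not guarantee.\<close>

lemma cover_by_keys:
  assumes "finite (key ` S)" "\<And>x y. x \<in> S \<Longrightarrow> y \<in> S \<Longrightarrow> key x = key y \<Longrightarrow> P x y"
  shows "\<exists>T\<subseteq>S. finite T \<and> card T \<le> card (key ` S) \<and> (\<forall>x\<in>S. \<exists>y\<in>T. P x y)"
proof (intro exI conjI ballI)
  let ?T = "inv_into S key ` key ` S"
  show "?T \<subseteq> S"
    by (auto intro: inv_into_into)
  show "finite ?T" "card ?T \<le> card (key ` S)"
    using assms(1) by (auto intro: card_image_le)
  fix x assume "x \<in> S"
  then show "\<exists>y\<in>?T. P x y"
    by (intro bexI[of _ "inv_into S key (key x)"] assms(2)) (auto simp: f_inv_into_f inv_into_into)
qed

text \<open>Associativity is left out so that the octonions are an instance; the metric estimates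
  rest on bilinearity and the multiplicative norm.\<close>

locale star_algebra =
  fixes mul :: "'a::euclidean_space \<Rightarrow> 'a \<Rightarrow> 'a" and star :: "'a \<Rightarrow> 'a" and one :: 'a
  assumes bilinear_mul: "bilinear mul"
    and linear_star: "linear star"
    and norm_mul: "norm (mul x y) = norm x * norm y"
    and norm_star: "norm (star x) = norm x"
    and norm_one: "norm one = 1"
    and star_one: "star one = one"
    and mul_one: "mul x one = x"
    and one_mul: "mul one x = x"
begin

lemmas mul_simps = bilinear_ladd[OF bilinear_mul] bilinear_radd[OF bilinear_mul]
  bilinear_lmul[OF bilinear_mul] bilinear_rmul[OF bilinear_mul]
  bilinear_lsub[OF bilinear_mul] bilinear_rsub[OF bilinear_mul]
  bilinear_lneg[OF bilinear_mul] bilinear_rneg[OF bilinear_mul]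
  bilinear_lzero[OF bilinear_mul] bilinear_rzero[OF bilinear_mul]

lemmas star_simps = linear_add[OF linear_star] linear_scale[OF linear_star]
  linear_diff[OF linear_star] linear_neg[OF linear_star] linear_0[OF linear_star] star_one

definition outer :: "'a ^ 'n \<Rightarrow> 'a ^ 'n \<Rightarrow> 'a ^ 'n ^ 'n" where
  "outer u v = (\<chi> j k. mul (u $ j) (star (v $ k)))"

text \<open>The matrix u star(u) / |u|^2. For octonions its idempotency is established for vectors
  with one coordinate equal to 1, see \<open>proj_in_OP2\<close>.\<close>

definition proj :: "'a ^ 'n \<Rightarrow> 'a ^ 'n ^ 'n" where
  "proj u = (1 / (norm u)\<^sup>2) *\<^sub>R outer u u"

lemma bilinear_outer: "bilinear outer"
  by (auto simp: bilinear_def outer_def vec_eq_iff mul_simps star_simps intro!: linearI)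

lemma power2_norm_vec: "(norm (u :: 'b::real_inner ^ 'n))\<^sup>2 = (\<Sum>j\<in>UNIV. (norm (u $ j))\<^sup>2)"
  by (simp add: power2_norm_eq_inner inner_vec_def)

lemma norm_outer: "norm (outer u v) = norm u * norm v"
proof -
  have "(norm (outer u v))\<^sup>2 = (norm u * norm v)\<^sup>2"
    by (simp add: power2_norm_vec power_mult_distrib outer_def norm_mul norm_star sum_product)
  then show ?thesis
    by (simp add: power2_eq_iff_nonneg)
qed

lemma norm_proj: "u \<noteq> 0 \<Longrightarrow> norm (proj u) = 1"
  by (simp add: proj_def norm_outer power2_eq_square)

text \<open>The constant 4 is 2 from the bilinearity of \<open>outer\<close> at unit vectors times 2
  from normalising vectors of length at least 1.\<close>

lemma proj_lipschitz:
  assumes "1 \<le> norm u" "1 \<le> norm v"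
  shows "norm (proj u - proj v) \<le> 4 * norm (u - v)"
proof -
  define a b where "a = (1 / norm u) *\<^sub>R u" and "b = (1 / norm v) *\<^sub>R v"
  have nz: "norm u > 0" "norm v > 0"
    using assms by linarith+
  have ab: "norm a = 1" "norm b = 1"
    using nz by (auto simp: a_def b_def)
  have "proj u = outer a a" "proj v = outer b b"
    by (auto simp: a_def b_def proj_def bilinear_lmul[OF bilinear_outer] bilinear_rmul[OF bilinear_outer] power2_eq_square)
  moreover have "outer a a - outer b b = outer (a - b) a + outer b (a - b)"
    by (simp add: bilinear_lsub[OF bilinear_outer] bilinear_rsub[OF bilinear_outer])
  ultimately have "norm (proj u - proj v) \<le> norm (a - b) * norm a + norm b * norm (a - b)"
    using norm_triangle_ineq[of "outer (a - b) a" "outer b (a - b)"] by (simp add: norm_outer)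
  then have 1: "norm (proj u - proj v) \<le> 2 * norm (a - b)"
    using ab by simp
  have "(norm v - norm u) / (norm u * norm v) = 1 / norm u - 1 / norm v"
    using nz by (simp add: field_simps)
  then have "a - b = (1 / norm u) *\<^sub>R ((u - v) + (norm v - norm u) *\<^sub>R b)"
    by (simp add: a_def b_def scaleR_right_distrib scaleR_right_diff_distrib scaleR_left_diff_distrib)
  then have "norm (a - b) = (1 / norm u) * norm ((u - v) + (norm v - norm u) *\<^sub>R b)"
    using nz by simp
  also have "\<dots> \<le> 1 * norm ((u - v) + (norm v - norm u) *\<^sub>R b)"
    using assms nz by (intro mult_right_mono) (auto simp: divide_le_eq_1)
  also have "\<dots> \<le> norm (u - v) + \<bar>norm v - norm u\<bar>"
    using norm_triangle_ineq[of "u - v" "(norm v - norm u) *\<^sub>R b"] ab by simp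
  also have "\<dots> \<le> 2 * norm (u - v)"
    using norm_triangle_ineq3[of u v] by (simp add: abs_minus_commute)
  finally show ?thesis using 1 by linarith
qed

end

section \<open>Affine charts: coverings and points in general position\<close>

text \<open>Charts replace lines: chart \<open>i\<close> consists of the vectors with
  \<open>w $ i = one\<close> and covers the points whose i-th diagonal entry is nonzero.
  \<open>D\<close> counts the real coordinates left free by a chart.\<close>

locale rank1_space = star_algebra mul star one
  for mul :: "'a::euclidean_space \<Rightarrow> 'a \<Rightarrow> 'a" and star one +
  fixes S :: "'p set" and \<theta> :: "'p \<Rightarrow> 'p \<Rightarrow> real" and \<phi> :: "'p \<Rightarrow> 'a ^ 'n ^ 'n" and D :: nat
  assumes theta_eq: "x \<in> S \<Longrightarrow> y \<in> S \<Longrightarrow> \<theta> x y = arccos (sqrt (\<phi> x \<bullet> \<phi> y))"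
    and transitive: "x \<in> S \<Longrightarrow> y \<in> S \<Longrightarrow> \<exists>f. isometry_of S \<theta> f \<and> f x = y"
    and chart: "x \<in> S \<Longrightarrow> \<phi> x $ i $ i \<noteq> 0 \<Longrightarrow> \<exists>w. w $ i = one \<and> \<phi> x = proj w"
    and diagonal_nonzero: "x \<in> S \<Longrightarrow> \<exists>i. \<phi> x $ i $ i \<noteq> 0"
    and chart_surj: "w $ i = one \<Longrightarrow> \<exists>x\<in>S. \<phi> x = proj w"
    and D_eq: "D = (CARD('n) - 1) * DIM('a)"
    and card_n: "2 \<le> CARD('n)"
begin

lemma chart_norm_ge:
  assumes "w $ i = one"
  shows "1 \<le> norm w"
  using Finite_Cartesian_Product.norm_nth_le[of w i] norm_one assms by simp

lemma norm_phi: "x \<in> S \<Longrightarrow> norm (\<phi> x) = 1"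
  using diagonal_nonzero chart norm_proj chart_norm_ge by (metis norm_zero not_one_le_zero)

lemma proj_nth: "proj w $ j $ k = (1 / (norm w)\<^sup>2) *\<^sub>R mul (w $ j) (star (w $ k))"
  by (simp add: proj_def outer_def)

text \<open>The diagonal entries have norms |w_j|^2 / |w|^2. In the chart of the largest one, where
  |w_i| = 1, no coordinate exceeds 1 in norm.\<close>

lemma bounded_chart:
  assumes x: "x \<in> S"
  shows "\<exists>i w. w $ i = one \<and> (\<forall>j. norm (w $ j) \<le> 1) \<and> \<phi> x = proj w"
proof -
  define f where "f i = norm (\<phi> x $ i $ i)" for i
  have "Max (range f) \<in> range f"
    by (rule Max_in) auto
  then obtain i where i: "Max (range f) = f i" by (rule rangeE)
  have fi: "f j \<le> f i" for j
    unfolding i[symmetric] by (intro Max_ge) auto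
  obtain j where "\<phi> x $ j $ j \<noteq> 0"
    using diagonal_nonzero[OF x] by blast
  then have "f j > 0" by (simp add: f_def)
  then have "f i > 0"
    using fi[of j] by linarith
  then obtain w where w: "w $ i = one" "\<phi> x = proj w"
    using chart[OF x, of i] by (auto simp: f_def)
  have w1: "norm w \<ge> 1"
    using chart_norm_ge w by blast
  have fw: "f j = (norm (w $ j))\<^sup>2 / (norm w)\<^sup>2" for j
    by (simp add: f_def w(2) proj_nth norm_mul norm_star power2_eq_square)
  have "norm (w $ j) \<le> 1" for j
  proof -
    have "(norm (w $ j))\<^sup>2 / (norm w)\<^sup>2 \<le> 1 / (norm w)\<^sup>2"
      using fi[of j] w norm_one by (simp add: fw)
    moreover have "0 < (norm w)\<^sup>2"
      using w1 by (intro zero_less_power) linarith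
    ultimately have "(norm (w $ j))\<^sup>2 \<le> 1"
      by (simp add: divide_le_cancel)
    then show ?thesis
      by (simp add: power_le_one_iff)
  qed
  then show ?thesis using w by blast
qed

lemma finite_cover:
  assumes r: "0 < \<rho>" "\<rho> \<le> 1"
  shows "\<exists>T\<subseteq>S. finite T \<and> real (card T) * \<rho> ^ D \<le> real CARD('n) * (40 * real D) ^ D \<and>
    (\<forall>x\<in>S. \<exists>y\<in>T. norm (\<phi> x - \<phi> y) < \<rho>)"
proof -
  have Dpos: "D > 0"
    using card_n by (simp add: D_eq)
  define ic where "ic x = (SOME (i, w). w $ i = one \<and> (\<forall>j. norm (w $ j) \<le> 1) \<and> \<phi> x = proj w)" for x
  have ic: "snd (ic x) $ fst (ic x) = one" "norm (snd (ic x) $ j) \<le> 1" "\<phi> x = proj (snd (ic x))" if "x \<in> S" for x j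
  proof -
    have "case ic x of (i, w) \<Rightarrow> w $ i = one \<and> (\<forall>j. norm (w $ j) \<le> 1) \<and> \<phi> x = proj w"
      unfolding ic_def by (rule someI_ex) (use bounded_chart[OF that] in auto)
    then show "snd (ic x) $ fst (ic x) = one" "norm (snd (ic x) $ j) \<le> 1" "\<phi> x = proj (snd (ic x))"
      by (auto simp: case_prod_unfold)
  qed
  \<comment> \<open>Vectors in one grid cell of side \<open>e\<close> differ by at most
    \<open>D * e = \<rho> / 8\<close>; the Lipschitz constant 4 makes this
    \<open>\<rho> / 2\<close>.\<close>
  define e where "e = \<rho> / (8 * real D)"
  have e: "0 < e" "e \<le> 1"
    using r Dpos by (auto simp: e_def field_simps intro: order_trans[of _ 1])
  define J where "J i = (UNIV - {i :: 'n}) \<times> (Basis :: 'a set)" for i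
  have J: "finite (J i)" "card (J i) = D" for i
    by (auto simp: J_def D_eq card_Diff_singleton)
  define fl where "fl w = (\<lambda>(j, b). \<lfloor>(w $ j \<bullet> b) / e\<rfloor>)" for w :: "'a ^ 'n"
  \<comment> \<open>The key records the chart and the cell. Restricting it to \<open>J\<close> omits
    the fixed coordinate, which gives the exponent \<open>D\<close> in the count.\<close>
  define key where "key x = (fst (ic x), restrict (fl (snd (ic x))) (J (fst (ic x))))" for x
  define m where "m = \<lceil>1 / e\<rceil>"
  have m: "0 \<le> m" "real_of_int m \<le> 1 / e + 1" "1 / e \<le> real_of_int m"
    using e unfolding m_def by (auto simp: le_ceiling_iff intro: less_imp_le order.strict_trans1[of _ 0])
  define I where "I = (SIGMA i:UNIV :: 'n set. (J i \<rightarrow>\<^sub>E {- m..m}))"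
  have finI: "finite I"
    using J by (auto simp: I_def intro!: finite_PiE)
  have kI: "key ` S \<subseteq> I"
  proof (intro image_subsetI)
    fix x assume x: "x \<in> S"
    have "fl (snd (ic x)) (j, b) \<in> {- m..m}" if "b \<in> Basis" for j b
    proof -
      have "\<bar>snd (ic x) $ j \<bullet> b\<bar> \<le> 1"
        using Basis_le_norm[OF that, of "snd (ic x) $ j"] ic(2)[OF x, of j] by linarith
      then have "\<bar>(snd (ic x) $ j \<bullet> b) / e\<bar> \<le> real_of_int m"
        using e m(3) by (simp add: field_simps)
      then show ?thesis
        unfolding abs_le_iff fl_def atLeastAtMost_iff prod.case le_floor_iff floor_le_iff by simp
    qed
    then show "key x \<in> I"
      by (auto simp: key_def I_def J_def)
  qed
  have "card I = CARD('n) * nat (2 * m + 1) ^ D"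
    using J m by (simp add: I_def card_PiE finite_PiE)
  then have "real (card (key ` S)) \<le> real CARD('n) * real (nat (2 * m + 1)) ^ D"
    using card_mono[OF finI kI] by (metis of_nat_le_iff of_nat_mult of_nat_power)
  also have "\<dots> \<le> real CARD('n) * (5 / e) ^ D"
  proof (intro mult_left_mono power_mono)
    \<comment> \<open>From \<open>m \<le> 1 / e + 1\<close> the number of cells per coordinate is at
      most 2 / e + 3, and \<open>e \<le> 1\<close> absorbs the 3.\<close>
    have "3 \<le> 3 / e"
      using e by (simp add: field_simps)
    then have "2 * real_of_int m + 1 \<le> 5 / e"
      using m(2) by simp
    then show "real (nat (2 * m + 1)) \<le> 5 / e"
      using m(1) by simp
  qed auto
  finally have card: "real (card (key ` S)) * \<rho> ^ D \<le> real CARD('n) * (40 * real D) ^ D"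
  proof -
    assume *: "real (card (key ` S)) \<le> real CARD('n) * (5 / e) ^ D"
    have "5 / e * \<rho> = 40 * real D"
      using r Dpos by (simp add: e_def)
    then have "real CARD('n) * (5 / e) ^ D * \<rho> ^ D = real CARD('n) * (40 * real D) ^ D"
      by (metis mult.assoc power_mult_distrib)
    then show ?thesis
      using mult_right_mono[OF *, of "\<rho> ^ D"] r by (metis less_imp_le zero_le_power)
  qed
  have close: "norm (\<phi> x - \<phi> y) < \<rho>" if xy: "x \<in> S" "y \<in> S" "key x = key y" for x y
  proof -
    define i where "i = fst (ic x)"
    define u v where "u = snd (ic x)" and "v = snd (ic y)"
    have i': "fst (ic y) = i" and res: "restrict (fl u) (J i) = restrict (fl v) (J i)"
      using xy(3) by (auto simp: key_def i_def u_def v_def)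
    have ui: "u $ i = one" "v $ i = one"
      using ic(1)[OF xy(1)] ic(1)[OF xy(2)] i' by (auto simp: i_def u_def v_def)
    have cl: "\<bar>(u - v) $ j \<bullet> b\<bar> \<le> e" if "(j, b) \<in> J i" for j b
    proof -
      have "fl u (j, b) = fl v (j, b)"
        using res that by (metis restrict_apply')
      then have "\<bar>(u $ j \<bullet> b) / e - (v $ j \<bullet> b) / e\<bar> < 1"
        unfolding fl_def by simp linarith
      then have "\<bar>((u - v) $ j \<bullet> b) / e\<bar> < 1"
        by (simp add: inner_diff_left diff_divide_distrib)
      then show ?thesis
        using e by (simp add: field_simps)
    qed
    have "norm (u - v) \<le> (\<Sum>j\<in>UNIV. norm ((u - v) $ j))"
      unfolding norm_vec_def by (rule L2_set_le_sum) simp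
    also have "\<dots> = (\<Sum>j\<in>UNIV - {i}. norm ((u - v) $ j))"
      using ui by (intro sum.mono_neutral_right) auto
    also have "\<dots> \<le> (\<Sum>j\<in>UNIV - {i}. \<Sum>b\<in>Basis. \<bar>(u - v) $ j \<bullet> b\<bar>)"
      by (intro sum_mono norm_le_l1)
    also have "\<dots> \<le> (\<Sum>j\<in>UNIV - {i}. \<Sum>b\<in>(Basis :: 'a set). e)"
      by (intro sum_mono cl) (auto simp: J_def)
    also have "\<dots> = real D * e"
      by (simp add: D_eq card_Diff_singleton)
    finally have "norm (u - v) \<le> \<rho> / 8"
      using Dpos by (simp add: e_def)
    moreover have "norm (\<phi> x - \<phi> y) \<le> 4 * norm (u - v)"
      using proj_lipschitz[of u v] chart_norm_ge ui ic(3) xy by (metis u_def v_def)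
    ultimately show ?thesis using r by linarith
  qed
  obtain T where "T \<subseteq> S" "finite T" "card T \<le> card (key ` S)" "\<forall>x\<in>S. \<exists>y\<in>T. norm (\<phi> x - \<phi> y) < \<rho>"
    using cover_by_keys[OF finite_subset[OF kI finI], of "\<lambda>x y. norm (\<phi> x - \<phi> y) < \<rho>"] close by blast
  moreover have "real (card T) * \<rho> ^ D \<le> real (card (key ` S)) * \<rho> ^ D"
    using calculation r by (intro mult_right_mono) auto
  ultimately show ?thesis
    using card by (meson order_trans)
qed

text \<open>The curve stays in one chart, while x ranges over all of \<open>S\<close>, including
  points that this chart misses.\<close>

lemma curve_general_position:
  "\<exists>(\<gamma> :: nat \<Rightarrow> 'p) m. range \<gamma> \<subseteq> S \<and>
      (\<forall>x\<in>S. \<forall>R>0. finite {t. norm (\<phi> x - \<phi> (\<gamma> t)) = R} \<and> card {t. norm (\<phi> x - \<phi> (\<gamma> t)) = R} \<le> m)"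
proof -
  obtain i :: 'n where True by simp
  define E where "E = (\<Union>j\<in>UNIV - {i}. axis j ` (Basis :: 'a set))"
  have "finite E" by (auto simp: E_def)
  then obtain l where l: "set l = E"
    using finite_list by blast
  \<comment> \<open>The chart vector gets index 0, where the exponent \<open>2 ^ 0 - 1\<close> is 0;
    hence the i-th coordinate of the curve is constantly \<open>one\<close>.\<close>
  define L where "L = axis i one # l"
  define v where "v k = L ! k" for k
  define M where "M = length L"
  have vM: "v ` {..<M} = insert (axis i one) E"
  proof -
    have "v ` {..<M} = set L"
      by (auto simp: v_def M_def in_set_conv_nth image_iff)
    then show ?thesis by (simp add: L_def l)
  qed
  have spanE: "w \<in> span (v ` {..<M})" if w: "w $ i = s *\<^sub>R one" for w s
  proof -
    have lin: "linear (axis j :: 'a \<Rightarrow> 'a ^ 'n)" for j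
      by (rule linearI) (auto simp: axis_def vec_eq_iff)
    have "axis j (w $ j) \<in> span (v ` {..<M})" for j
    proof (cases "j = i")
      case True
      then have "axis j (w $ j) = s *\<^sub>R axis i one"
        by (simp add: w linear_scale[OF lin])
      then show ?thesis
        unfolding vM by (auto intro: span_scale span_base)
    next
      case False
      have "axis j (w $ j) = axis j (\<Sum>b\<in>Basis. (w $ j \<bullet> b) *\<^sub>R b)"
        by (simp add: euclidean_representation)
      also have "\<dots> = (\<Sum>b\<in>Basis. (w $ j \<bullet> b) *\<^sub>R axis j b)"
        by (simp add: linear_sum[OF lin] linear_scale[OF lin])
      also have "\<dots> \<in> span (v ` {..<M})"
        unfolding vM using False by (intro span_sum span_scale span_base) (auto simp: E_def)
      finally show ?thesis .
    qed
    moreover have "w = (\<Sum>j\<in>UNIV. axis j (w $ j))"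
      by (simp add: vec_eq_iff axis_def if_distrib cong: if_cong)
    ultimately show ?thesis
      using span_sum[of UNIV "\<lambda>j. axis j (w $ j)"] by metis
  qed
  define u where "u t = sidon_curve v M t" for t
  have ui: "u t $ i = one" for t
  proof -
    have "v (Suc k) $ i = 0" if "k < length l" for k
    proof -
      have "v (Suc k) \<in> E"
        using that l by (auto simp: v_def L_def)
      then show ?thesis by (auto simp: E_def axis_def split: if_splits)
    qed
    moreover have "M = Suc (length l)"
      by (simp add: M_def L_def)
    ultimately show ?thesis
      by (simp add: u_def sidon_curve_def sum.lessThan_Suc_shift v_def[of 0] L_def axis_def
          del: sum.lessThan_Suc)
  qed
  then have "\<exists>x\<in>S. \<phi> x = proj (u t)" for t
    using chart_surj by blast
  then obtain \<gamma> where gam: "\<And>t. \<gamma> t \<in> S" "\<And>t. \<phi> (\<gamma> t) = proj (u t)"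
    by metis
  have main: "finite {t. norm (\<phi> x - \<phi> (\<gamma> t)) = R} \<and> card {t. norm (\<phi> x - \<phi> (\<gamma> t)) = R} \<le> 2 ^ (M + 1)"
    if x: "x \<in> S" and R: "R > 0" for x R
  proof -
    \<comment> \<open>This is the value of the inner product at chord \<open>R\<close>, so
      \<open>B w w = 0\<close> says that \<open>proj w\<close> lies on the sphere.\<close>
    define c where "c = 1 - R\<^sup>2 / 2"
    have c1: "c \<noteq> 1" using R by (simp add: c_def)
    define B where "B a b = \<phi> x \<bullet> outer a b - c * (a \<bullet> b)" for a b
    have B: "bilinear B"
      unfolding B_def bilinear_def
      by (auto intro!: linearI simp: bilinear_ladd[OF bilinear_outer] bilinear_radd[OF bilinear_outer]
          bilinear_lmul[OF bilinear_outer] bilinear_rmul[OF bilinear_outer] inner_add_left inner_add_right algebra_simps)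
    have BE: "B w w = (norm w)\<^sup>2 * (\<phi> x \<bullet> proj w - c)" for w
      by (cases "w = 0") (auto simp: B_def proj_def power2_norm_eq_inner algebra_simps bilinear_lzero[OF bilinear_outer])
    \<comment> \<open>If the chart contains x, its own vector gives the factor \<open>1 - c\<close>.
      Otherwise \<open>axis i one\<close> gives \<open>- c\<close>; and if \<open>c = 0\<close> too,
      \<open>axis j one\<close> with a nonzero j-th diagonal entry gives a positive value.\<close>
    have "\<exists>w s. w $ i = s *\<^sub>R one \<and> B w w \<noteq> 0"
    proof (cases "\<phi> x $ i $ i = 0")
      case False
      then obtain w where w: "w $ i = one" "\<phi> x = proj w"
        using chart[OF x] by blast
      have "\<phi> x \<bullet> \<phi> x = 1"
        using norm_phi[OF x] by (simp add: norm_eq_1)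
      then have "B w w = (norm w)\<^sup>2 * (1 - c)"
        by (simp add: BE flip: w(2))
      moreover have "norm w \<ge> 1"
        by (rule chart_norm_ge[OF w(1)])
      ultimately have "B w w \<noteq> 0" using c1 by auto
      then show ?thesis
        using w(1) by (intro exI[of _ w] exI[of _ 1]) simp
    next
      case True
      have axB: "B (axis j one) (axis j one) = \<phi> x $ j $ j \<bullet> one - c" for j
      proof -
        have "outer (axis j one) (axis j one) = axis j (axis j one)"
          by (auto simp: outer_def axis_def vec_eq_iff mul_simps star_simps mul_one)
        then show ?thesis
          by (simp add: B_def inner_axis inner_axis_axis norm_one flip: norm_eq_1)
      qed
      show ?thesis
      proof (cases "c = 0")
        case False
        then show ?thesis
          using axB[of i] True by (intro exI[of _ "axis i one"] exI[of _ 1]) (auto simp: axis_def)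
      next
        case c0: True
        obtain j where j: "\<phi> x $ j $ j \<noteq> 0"
          using diagonal_nonzero[OF x] by blast
        then obtain w where w: "w $ j = one" "\<phi> x = proj w"
          using chart[OF x] by blast
        have "\<phi> x $ j $ j \<bullet> one = 1 / (norm w)\<^sup>2"
          using w norm_one by (simp add: proj_nth star_one mul_one norm_eq_1)
        then have "B (axis j one) (axis j one) \<noteq> 0"
          using axB[of j] c0 chart_norm_ge[OF w(1)] by auto
        moreover have "j \<noteq> i" using j True by auto
        ultimately show ?thesis
          by (intro exI[of _ "axis j one"] exI[of _ 0]) (auto simp: axis_def)
      qed
    qed
    then obtain w s where w: "w $ i = s *\<^sub>R one" "B w w \<noteq> 0" by blast
    have "{t. norm (\<phi> x - \<phi> (\<gamma> t)) = R} \<subseteq> {t. B (u t) (u t) = 0}"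
    proof
      fix t assume "t \<in> {t. norm (\<phi> x - \<phi> (\<gamma> t)) = R}"
      then have "R\<^sup>2 = (norm (\<phi> x - \<phi> (\<gamma> t)))\<^sup>2" by simp
      also have "\<dots> = 2 - 2 * (\<phi> x \<bullet> \<phi> (\<gamma> t))"
        using norm_phi[OF x] norm_phi[OF gam(1)[of t]]
        by (simp add: power2_norm_eq_inner inner_diff_left inner_diff_right inner_commute norm_eq_1)
      finally have "\<phi> x \<bullet> proj (u t) = c"
        unfolding c_def gam by linarith
      then show "t \<in> {t. B (u t) (u t) = 0}"
        by (simp add: BE)
    qed
    moreover have "finite {t. B (u t) (u t) = 0}" "card {t. B (u t) (u t) = 0} \<le> 2 ^ (M + 1)"
      using sidon_curve_zeros[OF B spanE[OF w(1)] w(2)] by (simp_all add: u_def)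
    ultimately show ?thesis
      by (meson card_mono finite_subset order_trans)
  qed
  show ?thesis
    using gam(1) main by (intro exI[of _ \<gamma>] exI[of _ "2 ^ (M + 1)"]) auto
qed

sublocale chordal_space S \<theta> \<phi> D
proof unfold_locales
  show "\<exists>K. \<forall>\<rho>. 0 < \<rho> \<longrightarrow> \<rho> \<le> 1 \<longrightarrow>
      (\<exists>T\<subseteq>S. finite T \<and> real (card T) * \<rho> ^ D \<le> K \<and> (\<forall>x\<in>S. \<exists>y\<in>T. norm (\<phi> x - \<phi> y) < \<rho>))"
    using finite_cover by blast
  show "0 < D"
    using card_n by (simp add: D_eq)
qed (use norm_phi theta_eq transitive curve_general_position in auto)

lemma hyperuniform_imp_uniform:
  assumes "invariant_prob S \<theta> \<sigma>" "point_sets S X" "hyperuniform_threshold S \<theta> \<sigma> D X"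
  shows "uniformly_distributed S \<theta> \<sigma> X"
proof -
  interpret chordal_measure_space S \<theta> \<phi> D \<sigma>
    by unfold_locales (rule assms(1))
  show ?thesis
    by (rule hyperuniform_imp_uniformly_distributed[OF assms(2,3)])
qed

end

section \<open>Projective spaces over associative star algebras\<close>

locale assoc_star_algebra = star_algebra mul star one
  for mul :: "'a::euclidean_space \<Rightarrow> 'a \<Rightarrow> 'a" and star one +
  assumes mul_assoc: "mul (mul x y) z = mul x (mul y z)"
    and star_star: "star (star x) = x"
    and star_mul: "star (mul x y) = mul (star y) (star x)"
    and star_mul_self: "mul (star x) x = (norm x)\<^sup>2 *\<^sub>R one"
    and inner_mul_left: "mul x y \<bullet> z = y \<bullet> mul (star x) z"
    and inner_mul_right: "mul x y \<bullet> z = x \<bullet> mul z (star y)"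
begin

lemma mul_star_self: "mul x (star x) = (norm x)\<^sup>2 *\<^sub>R one"
  using star_mul_self[of "star x"] by (simp add: star_star norm_star)

lemma linear_mul_right: "linear (\<lambda>x. mul x y)"
  using bilinear_mul by (auto simp: bilinear_def)

definition rscale :: "'a ^ 'n \<Rightarrow> 'a \<Rightarrow> 'a ^ 'n" where
  "rscale u c = (\<chi> i. mul (u $ i) c)"

definition herm :: "'a ^ 'n \<Rightarrow> 'a ^ 'n \<Rightarrow> 'a" where
  "herm = herm_inner mul star"

lemma span_line_eq: "span_line mul u = range (rscale u)"
  by (simp add: span_line_def rscale_def[abs_def])

lemma rscale_rscale: "rscale (rscale u c) d = rscale u (mul c d)"
  by (simp add: rscale_def mul_assoc)

lemma rscale_one: "rscale u one = u"
  by (simp add: rscale_def mul_one)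

lemma bilinear_rscale: "bilinear rscale"
  by (auto simp: bilinear_def rscale_def vec_eq_iff mul_simps intro!: linearI)

lemma bilinear_herm: "bilinear herm"
  by (auto simp: bilinear_def herm_def herm_inner_def mul_simps star_simps sum.distrib scaleR_sum_right
      intro!: linearI)

lemmas herm_simps = bilinear_ladd[OF bilinear_herm] bilinear_radd[OF bilinear_herm]
  bilinear_lmul[OF bilinear_herm] bilinear_rmul[OF bilinear_herm]
  bilinear_lsub[OF bilinear_herm] bilinear_rsub[OF bilinear_herm]

lemmas rscale_simps = bilinear_lmul[OF bilinear_rscale] bilinear_rmul[OF bilinear_rscale]
  bilinear_lsub[OF bilinear_rscale] bilinear_rsub[OF bilinear_rscale]
  bilinear_lneg[OF bilinear_rscale] bilinear_rneg[OF bilinear_rscale]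
  bilinear_lzero[OF bilinear_rscale] bilinear_rzero[OF bilinear_rscale]

lemma norm_rscale: "norm (rscale u c) = norm u * norm c"
proof -
  have "(norm (rscale u c))\<^sup>2 = (norm u * norm c)\<^sup>2"
    by (simp add: power2_norm_vec rscale_def norm_mul power_mult_distrib sum_distrib_right)
  then show ?thesis by (simp add: power2_eq_iff_nonneg)
qed

lemma herm_rscale_right: "herm u (rscale v c) = mul (herm u v) c"
  by (simp add: herm_def herm_inner_def rscale_def linear_sum[OF linear_mul_right] mul_assoc)

lemma star_herm: "star (herm u v) = herm v u"
  by (simp add: herm_def herm_inner_def linear_sum[OF linear_star] star_mul star_star)

lemma herm_rscale_left: "herm (rscale u c) v = mul (star c) (herm u v)"
  by (metis herm_rscale_right star_herm star_mul star_star)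

lemma herm_self: "herm u u = (norm u)\<^sup>2 *\<^sub>R one"
  by (simp add: herm_def herm_inner_def star_mul_self power2_norm_vec scaleR_sum_left)

text \<open>The trace identity Tr(u star(u) v star(v)) = |<u, v>|^2, obtained entrywise by moving
  factors across the inner product with their adjoints.\<close>

lemma inner_outer: "outer u u \<bullet> outer v v = (norm (herm u v))\<^sup>2"
proof -
  have *: "mul (u $ j) (star (u $ k)) \<bullet> mul (v $ j) (star (v $ k))
      = mul (star (u $ j)) (v $ j) \<bullet> mul (star (u $ k)) (v $ k)" for j k
  proof -
    have "mul (star (u $ j)) (v $ j) \<bullet> mul (star (u $ k)) (v $ k)
        = v $ j \<bullet> mul (mul (u $ j) (star (u $ k))) (v $ k)"
      by (simp add: inner_mul_left star_star mul_assoc)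
    also have "\<dots> = mul (v $ j) (star (v $ k)) \<bullet> mul (u $ j) (star (u $ k))"
      by (simp add: inner_mul_right[of "v $ j"] star_star)
    finally show ?thesis by (simp add: inner_commute)
  qed
  have "(norm (herm u v))\<^sup>2 = (\<Sum>j\<in>UNIV. \<Sum>k\<in>UNIV. mul (star (u $ j)) (v $ j) \<bullet> mul (star (u $ k)) (v $ k))"
    by (simp add: herm_def herm_inner_def power2_norm_eq_inner inner_sum_left inner_sum_right)
      (rule sum.swap)
  then show ?thesis
    by (simp add: inner_vec_def outer_def *)
qed

lemma inner_proj: "proj u \<bullet> proj v = (norm (herm u v))\<^sup>2 / ((norm u)\<^sup>2 * (norm v)\<^sup>2)"
  by (simp add: proj_def inner_outer)

text \<open>The two scalars meet in the middle as \<open>mul c (star c)\<close>, a real multiple of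
  \<open>one\<close>.\<close>

lemma outer_rscale: "outer (rscale u c) (rscale u c) = (norm c)\<^sup>2 *\<^sub>R outer u u"
proof -
  have "mul (mul a c) (mul (star c) b) = (norm c)\<^sup>2 *\<^sub>R mul a b" for a b
    by (metis mul_assoc mul_star_self mul_simps(3,4) mul_one)
  then show ?thesis
    by (simp add: outer_def rscale_def star_mul vec_eq_iff)
qed

lemma proj_rscale: "c \<noteq> 0 \<Longrightarrow> proj (rscale u c) = proj u"
  by (simp add: proj_def outer_rscale norm_rscale power_mult_distrib)

text \<open>On \<open>proj_space\<close> the choice is immaterial by
  \<open>proj_rscale\<close>.\<close>

definition line_proj :: "('a ^ 'n) set \<Rightarrow> 'a ^ 'n ^ 'n" where
  "line_proj L = proj (SOME u. u \<in> L \<and> u \<noteq> 0)"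

lemma span_line_nonzero:
  assumes "a \<in> span_line mul u" "a \<noteq> 0"
  obtains c where "c \<noteq> 0" "a = rscale u c"
proof -
  obtain c where c: "a = rscale u c"
    using assms(1) by (auto simp: span_line_eq)
  then have "c \<noteq> 0"
    using assms(2) by (auto simp: rscale_simps)
  then show thesis using c that by blast
qed

lemma mem_span_line: "u \<in> span_line mul u"
  unfolding span_line_eq by (metis rangeI rscale_one)

lemma line_proj_span: "u \<noteq> 0 \<Longrightarrow> line_proj (span_line mul u) = proj u"
proof -
  assume u: "u \<noteq> 0"
  let ?a = "SOME a. a \<in> span_line mul u \<and> a \<noteq> 0"
  have "?a \<in> span_line mul u \<and> ?a \<noteq> 0"
    by (rule someI[of _ u]) (simp add: u mem_span_line)
  then obtain c where "c \<noteq> 0" "?a = rscale u c"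
    by (auto elim: span_line_nonzero)
  then show ?thesis
    by (simp add: line_proj_def proj_rscale)
qed

lemma span_line_rscale:
  assumes "c \<noteq> 0"
  shows "span_line mul (rscale u c) = span_line mul u"
proof -
  define d where "d = (1 / (norm c)\<^sup>2) *\<^sub>R star c"
  have "mul c d = one"
    using assms by (simp add: d_def mul_simps mul_star_self)
  then have "rscale (rscale u c) (mul d e) = rscale u e" for e
    by (metis rscale_rscale mul_assoc one_mul)
  then have "rscale u e \<in> range (rscale (rscale u c))" for e
    by (metis rangeI)
  then show ?thesis
    by (auto simp: span_line_eq rscale_rscale)
qed

lemma unit_vector:
  assumes "L \<in> proj_space mul"
  obtains u where "norm u = 1" "L = span_line mul u" "u \<in> L"
proof -
  obtain u where u: "u \<noteq> 0" "L = span_line mul u"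
    using assms by (auto simp: proj_space_def)
  let ?c = "(1 / norm u) *\<^sub>R one"
  have "norm (rscale u ?c) = 1"
    using u by (simp add: norm_rscale norm_one)
  moreover have "L = span_line mul (rscale u ?c)"
    using u norm_one by (subst span_line_rscale) auto
  ultimately show ?thesis
    using that mem_span_line by blast
qed

text \<open>The value is the same for all unit vectors of the two lines, and such vectors exist, so
  the description \<open>THE\<close> in \<open>proj_dist\<close> is met.\<close>

lemma proj_dist_eq:
  assumes L: "L \<in> proj_space mul" and M: "M \<in> proj_space mul"
  shows "proj_dist mul star L M = arccos (sqrt (line_proj L \<bullet> line_proj M))"
proof -
  have *: "norm (herm_inner mul star a b) = sqrt (line_proj L \<bullet> line_proj M)"
    if ab: "a \<in> L" "b \<in> M" "norm a = 1" "norm b = 1" for a b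
  proof -
    obtain u v where u: "u \<noteq> 0" "L = span_line mul u" and v: "v \<noteq> 0" "M = span_line mul v"
      using L M by (auto simp: proj_space_def)
    have nz: "a \<noteq> 0" "b \<noteq> 0" using ab by auto
    obtain c where c: "c \<noteq> 0" "a = rscale u c"
      using span_line_nonzero[of a u] ab nz u by blast
    obtain d where d: "d \<noteq> 0" "b = rscale v d"
      using span_line_nonzero[of b v] ab nz v by blast
    have "line_proj L = proj a" "line_proj M = proj b"
      using u v c d by (auto simp: line_proj_span proj_rscale)
    then have "line_proj L \<bullet> line_proj M = (norm (herm a b))\<^sup>2"
      using ab by (simp add: inner_proj)
    then show ?thesis by (simp add: herm_def)
  qed
  obtain u where "norm u = 1" "u \<in> L" using unit_vector[OF L] by metis
  moreover obtain v where "norm v = 1" "v \<in> M" using unit_vector[OF M] by metis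
  ultimately show ?thesis
    unfolding proj_dist_def by (intro the_equality) (use * in \<open>auto, metis\<close>)
qed

section \<open>Unitary reflections and transitivity on lines\<close>

text \<open>The Householder reflection in the hyperplane orthogonal to \<open>w\<close>. The scalar
  stands on the right of \<open>w\<close>, which makes the map linear over right scalars, so it
  sends lines to lines.\<close>

definition reflect :: "'a ^ 'n \<Rightarrow> 'a ^ 'n \<Rightarrow> 'a ^ 'n" where
  "reflect w z = z - (2 / (norm w)\<^sup>2) *\<^sub>R rscale w (herm w z)"

lemma reflect_rscale: "reflect w (rscale z c) = rscale (reflect w z) c"
  by (simp add: reflect_def herm_rscale_right rscale_simps rscale_rscale)

lemma herm_reflect_self: "w \<noteq> 0 \<Longrightarrow> herm w (reflect w z) = - herm w z"
  by (simp add: reflect_def herm_simps herm_rscale_right herm_self mul_simps one_mul algebra_simps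
      flip: scaleR_2)

lemma reflect_reflect: "w \<noteq> 0 \<Longrightarrow> reflect w (reflect w z) = z"
  unfolding reflect_def[of w "reflect w z"] herm_reflect_self
  by (simp add: reflect_def rscale_simps)

lemma herm_reflect: "w \<noteq> 0 \<Longrightarrow> herm (reflect w y) (reflect w z) = herm y z"
proof -
  assume w: "w \<noteq> 0"
  have "herm (reflect w y) (reflect w z) =
      herm y (reflect w z) - (2 / (norm w)\<^sup>2) *\<^sub>R mul (herm y w) (herm w (reflect w z))"
    by (simp add: reflect_def[of w y] herm_simps herm_rscale_left star_herm)
  also have "\<dots> = herm y z"
    using w by (simp add: herm_reflect_self mul_simps) (simp add: reflect_def herm_simps herm_rscale_right)
  finally show ?thesis .
qed

lemma norm_reflect: "w \<noteq> 0 \<Longrightarrow> norm (reflect w z) = norm z"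
proof -
  assume "w \<noteq> 0"
  then have "(norm (reflect w z))\<^sup>2 *\<^sub>R one = (norm z)\<^sup>2 *\<^sub>R one"
    using herm_reflect[of w z z] by (simp add: herm_self)
  moreover have "one \<noteq> 0" using norm_one by auto
  ultimately show ?thesis
    by (simp add: power2_eq_iff_nonneg)
qed

lemma reflect_span_line: "reflect w ` span_line mul u = span_line mul (reflect w u)"
  by (auto simp: span_line_eq reflect_rscale image_iff)

lemma isometry_reflect:
  assumes w: "w \<noteq> 0"
  shows "isometry_of (proj_space mul) (proj_dist mul star) (\<lambda>L. reflect w ` L)"
proof -
  have nz: "reflect w u \<noteq> 0" if "u \<noteq> 0" for u
    using that norm_reflect[OF w, of u] by auto
  have mem: "reflect w ` L \<in> proj_space mul" if L: "L \<in> proj_space mul" for L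
  proof -
    obtain u where "u \<noteq> 0" "L = span_line mul u"
      using L by (auto simp: proj_space_def)
    then show ?thesis
      using nz[of u] by (auto simp: proj_space_def reflect_span_line)
  qed
  have inv: "reflect w ` reflect w ` L = L" for L
    by (simp add: image_image reflect_reflect[OF w])
  have "proj_dist mul star (reflect w ` L) (reflect w ` M) = proj_dist mul star L M"
    if LM: "L \<in> proj_space mul" "M \<in> proj_space mul" for L M
  proof -
    obtain u v where uv: "u \<noteq> 0" "L = span_line mul u" "v \<noteq> 0" "M = span_line mul v"
      using LM by (auto simp: proj_space_def)
    show ?thesis
      unfolding proj_dist_eq[OF LM] proj_dist_eq[OF mem mem, OF LM]
      using uv nz by (simp add: reflect_span_line line_proj_span inner_proj herm_reflect[OF w] norm_reflect[OF w])
  qed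
  then show ?thesis
    by (intro isometry_ofI[where g = "\<lambda>L. reflect w ` L"] mem inv)
qed

text \<open>The reflection in u - v exchanges unit vectors u and v whose product is real, and a unit
  scalar applied to the second vector achieves this.\<close>

lemma proj_space_transitive:
  assumes L: "L \<in> proj_space mul" and M: "M \<in> proj_space mul"
  shows "\<exists>f. isometry_of (proj_space mul) (proj_dist mul star) f \<and> f L = M"
proof -
  obtain u where u: "norm u = 1" "L = span_line mul u" using unit_vector[OF L] by metis
  obtain v0 where v0: "norm v0 = 1" "M = span_line mul v0" using unit_vector[OF M] by metis
  define h where "h = herm u v0"
  \<comment> \<open>This phase turns the product \<open>h\<close> into its norm; orthogonal vectors
    already have product 0.\<close>
  define c where "c = (if h = 0 then one else (1 / norm h) *\<^sub>R star h)"
  have c: "norm c = 1"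
    by (simp add: c_def norm_one norm_star)
  define v where "v = rscale v0 c"
  have v: "norm v = 1" "M = span_line mul v"
    using c v0 span_line_rscale[of c v0] by (force simp: v_def norm_rscale)+
  have huv: "herm u v = norm h *\<^sub>R one"
    by (simp add: v_def herm_rscale_right c_def mul_simps mul_star_self power2_eq_square flip: h_def)
  show ?thesis
  proof (cases "u = v")
    case True
    then show ?thesis
      using u v by (intro exI[of _ "\<lambda>x. x"]) (auto intro: isometry_ofI[where g = "\<lambda>x. x"])
  next
    case False
    define w where "w = u - v"
    have w: "w \<noteq> 0" using False by (simp add: w_def)
    have hvu: "herm v u = norm h *\<^sub>R one"
      using star_herm[of u v] huv by (simp add: star_simps)
    have hw: "herm w u = (1 - norm h) *\<^sub>R one"
      using u hvu by (simp add: w_def herm_simps herm_self algebra_simps)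
    \<comment> \<open>The squared length is 2 (1 - |h|), exactly what makes the coefficient of
      \<open>w\<close> in the reflection of u equal to 1.\<close>
    have "(norm w)\<^sup>2 *\<^sub>R one = (2 - 2 * norm h) *\<^sub>R one"
      using u v huv hvu by (simp add: w_def herm_simps herm_self algebra_simps flip: herm_self scaleR_2)
        (simp add: herm_self algebra_simps flip: scaleR_2)
    moreover have "one \<noteq> 0" using norm_one by auto
    ultimately have "(norm w)\<^sup>2 = 2 * (1 - norm h)"
      by simp
    moreover have "(norm w)\<^sup>2 \<noteq> 0" using w by simp
    ultimately have "(2 / (norm w)\<^sup>2) * (1 - norm h) = 1"
      by (cases "norm h = 1") simp_all
    moreover have "reflect w u = u - ((2 / (norm w)\<^sup>2) * (1 - norm h)) *\<^sub>R w"
      by (simp add: reflect_def hw rscale_simps rscale_one)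
    ultimately have "reflect w u = v"
      by (simp only: scaleR_one) (simp add: w_def)
    then show ?thesis
      using isometry_reflect[OF w] u(2) v(2) reflect_span_line[of w u] by metis
  qed
qed

lemma rank1_space_proj_space:
  assumes "2 \<le> CARD('n::finite)"
  shows "rank1_space mul star one (proj_space mul) (proj_dist mul star)
    (line_proj :: ('a ^ 'n) set \<Rightarrow> _) ((CARD('n) - 1) * DIM('a))"
proof unfold_locales
  fix L :: "('a ^ 'n) set" and i assume L: "L \<in> proj_space mul"
  obtain u where u: "u \<noteq> 0" "L = span_line mul u"
    using L by (auto simp: proj_space_def)
  have diag: "line_proj L $ i $ i = ((norm (u $ i))\<^sup>2 / (norm u)\<^sup>2) *\<^sub>R one" for i
    using u by (simp add: line_proj_span proj_def outer_def mul_star_self)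
  have one0: "one \<noteq> 0" using norm_one by auto
  show "\<exists>i. line_proj L $ i $ i \<noteq> 0"
  proof -
    obtain j where "u $ j \<noteq> 0"
      using u by (auto simp: vec_eq_iff)
    then have "line_proj L $ j $ j \<noteq> 0"
      using u one0 by (subst diag) simp
    then show ?thesis by blast
  qed
  assume "line_proj L $ i $ i \<noteq> 0"
  then have ui: "u $ i \<noteq> 0" by (auto simp: diag)
  define c where "c = (1 / (norm (u $ i))\<^sup>2) *\<^sub>R star (u $ i)"
  have "norm c \<noteq> 0"
    using ui by (simp add: c_def norm_star)
  then have "proj (rscale u c) = proj u"
    by (intro proj_rscale) auto
  moreover have "rscale u c $ i = one"
    using ui by (simp add: rscale_def c_def mul_simps mul_star_self)
  ultimately show "\<exists>w. w $ i = one \<and> line_proj L = proj w"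
    using u by (metis line_proj_span)
next
  fix w :: "'a ^ 'n" and i assume "w $ i = one"
  then have "w \<noteq> 0" using norm_one by auto
  then show "\<exists>x\<in>proj_space mul. line_proj x = proj w"
    by (auto simp: proj_space_def line_proj_span)
qed (use assms proj_dist_eq proj_space_transitive in auto)

end

section \<open>Real, complex and quaternionic scalars\<close>

lemma assoc_star_algebra_real: "assoc_star_algebra (*) (\<lambda>x. x) (1::real)"
  by unfold_locales (auto simp: bilinear_def abs_mult power2_eq_square algebra_simps intro!: linearI)

lemma assoc_star_algebra_complex: "assoc_star_algebra (*) cnj (1::complex)"
proof (intro assoc_star_algebra.intro star_algebra.intro assoc_star_algebra_axioms.intro)
  show "cnj x * x = (norm x)\<^sup>2 *\<^sub>R 1" for x
    by (simp add: complex_eq_iff cmod_power2) (simp add: power2_eq_square)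
qed (auto simp: bilinear_def norm_mult algebra_simps inner_complex_def intro!: linearI)

lemma assoc_star_algebra_quaternion: "assoc_star_algebra qmult qcnj (1, 0)"
proof (intro assoc_star_algebra.intro star_algebra.intro assoc_star_algebra_axioms.intro)
  show "bilinear qmult"
    by (auto simp: bilinear_def qmult_def algebra_simps scaleR_conv_of_real intro!: linearI)
  show "linear qcnj"
    by (auto simp: qcnj_def intro!: linearI)
  show "norm (qcnj x) = norm x" for x
    by (simp add: qcnj_def norm_prod_def)
  show "qmult (qcnj x) x = (norm x)\<^sup>2 *\<^sub>R (1, 0)" for x
    by (simp add: qmult_def qcnj_def norm_prod_def cmod_power2 complex_eq_iff)
      (simp add: power2_eq_square algebra_simps)
  show "qmult x y \<bullet> z = y \<bullet> qmult (qcnj x) z" for x y z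
    by (simp add: qmult_def qcnj_def inner_prod_def inner_complex_def algebra_simps)
  show "qmult x y \<bullet> z = x \<bullet> qmult z (qcnj y)" for x y z
    by (simp add: qmult_def qcnj_def inner_prod_def inner_complex_def algebra_simps)
  show "norm (qmult x y) = norm x * norm y" for x y
    by (rule norm_qmult)
qed (auto simp: qmult_def qcnj_def algebra_simps norm_prod_def)

section \<open>The octonionic projective plane\<close>

text \<open>Rewriting squared moduli as products turns the octonion cancellation law into a
  polynomial identity in complex components and their conjugates.\<close>

lemma cmod_sq_scaleR: "(cmod x)\<^sup>2 *\<^sub>R y = x * (cnj x * y)"
  by (simp add: complex_eq_iff cmod_power2) (simp add: power2_eq_square algebra_simps)

lemma star_algebra_octonion: "star_algebra omult ocnj (oreal 1)"
proof (intro star_algebra.intro)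
  show "bilinear omult"
    by (auto simp: bilinear_def omult_def qmult_def qcnj_def algebra_simps scaleR_conv_of_real intro!: linearI)
  show "linear ocnj"
    by (auto simp: ocnj_def qcnj_def intro!: linearI)
  show "norm (omult x y) = norm x * norm y" for x y
    by (rule norm_omult)
qed (auto simp: omult_def ocnj_def qmult_def qcnj_def oreal_def norm_prod_def)

interpretation oct: star_algebra omult ocnj "oreal 1"
  by (rule star_algebra_octonion)

lemma ocnj_ocnj [simp]: "ocnj (ocnj x) = x"
  by (simp add: ocnj_def qcnj_def)

lemma ocnj_omult: "ocnj (omult x y) = omult (ocnj y) (ocnj x)"
  by (simp add: omult_def ocnj_def qmult_def qcnj_def algebra_simps)

lemma omult_ocnj_self: "omult x (ocnj x) = oreal ((norm x)\<^sup>2)"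
  by (simp add: omult_def ocnj_def qmult_def qcnj_def oreal_def norm_prod_def zero_prod_def algebra_simps
      complex_eq_iff cmod_power2) (simp add: power2_eq_square)

lemma ocnj_omult_self: "omult (ocnj x) x = oreal ((norm x)\<^sup>2)"
  using omult_ocnj_self[of "ocnj x"] by (simp add: oct.norm_star)

lemma omult_cancel_left: "omult (ocnj x) (omult x y) = (norm x)\<^sup>2 *\<^sub>R y"
  by (simp add: prod_eq_iff omult_def ocnj_def qmult_def qcnj_def norm_prod_def algebra_simps scaleR_left_distrib
      cmod_sq_scaleR)

lemma omult_cancel_right: "omult (omult y x) (ocnj x) = (norm x)\<^sup>2 *\<^sub>R y"
  using arg_cong[OF omult_cancel_left[of "ocnj x" "ocnj y"], of ocnj]
  by (simp add: ocnj_omult oct.star_simps oct.norm_star)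

text \<open>The Moufang identities are the substitute for associativity; after expansion each is an
  identity of commutative polynomials.\<close>

lemma left_moufang: "omult x (omult z (omult x y)) = omult (omult x (omult z x)) y"
  by (simp add: prod_eq_iff omult_def qmult_def qcnj_def algebra_simps)

lemma right_moufang: "omult (omult (omult y x) z) x = omult y (omult x (omult z x))"
  by (simp add: prod_eq_iff omult_def qmult_def qcnj_def algebra_simps)

lemma middle_moufang: "omult (omult x y) (omult z x) = omult x (omult (omult y z) x)"
  by (simp add: prod_eq_iff omult_def qmult_def qcnj_def algebra_simps)

lemma flexible: "omult (omult x y) x = omult x (omult y x)"
  using middle_moufang[of x y "oreal 1"] by (simp add: oct.mul_one oct.one_mul)

lemma oreal_eq: "oreal t = t *\<^sub>R oreal 1"
  by (simp add: oreal_def scaleR_conv_of_real)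

lemma omult_oreal [simp]: "omult (oreal t) x = t *\<^sub>R x" "omult x (oreal t) = t *\<^sub>R x"
  by (simp_all add: oreal_eq[of t] oct.mul_simps oct.mul_one oct.one_mul)

lemma oRe_simps: "oRe (oreal t) = t" "oRe (x + y) = oRe x + oRe y" "oRe (t *\<^sub>R x) = t * oRe x"
    "oRe 0 = 0"
  by (auto simp: oRe_def oreal_def zero_prod_def)

lemma oRe_sum: "oRe (sum f A) = (\<Sum>i\<in>A. oRe (f i))"
  by (induction A rule: infinite_finite_induct) (auto simp: oRe_simps)

lemma oRe_omult_ocnj: "oRe (omult x (ocnj y)) = x \<bullet> y"
  by (simp add: oRe_def omult_def ocnj_def qmult_def qcnj_def inner_prod_def inner_complex_def)

lemma norm_oreal: "norm (oreal t) = \<bar>t\<bar>"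
  by (simp add: oreal_def norm_prod_def)

lemma oreal_inj [simp]: "oreal s = oreal t \<longleftrightarrow> s = t"
  by (simp add: oreal_def)

lemma oreal_arith: "oreal s + oreal t = oreal (s + t)" "oreal s - oreal t = oreal (s - t)"
    "r *\<^sub>R oreal t = oreal (r * t)" "oreal 0 = 0"
  by (simp_all add: oreal_def scaleR_conv_of_real zero_prod_def)

lemma ocnj_oreal [simp]: "ocnj (oreal t) = oreal t"
  by (simp add: oreal_def ocnj_def qcnj_def)

lemma self_ocnj_real: "x = ocnj x \<Longrightarrow> x = oreal (oRe x)"
  by (auto simp: ocnj_def qcnj_def oreal_def oRe_def prod_eq_iff complex_eq_iff)

section \<open>Points of the octonionic plane as rank one matrices\<close>

lemma OP2_iff:
  "P \<in> OP2 \<longleftrightarrow> (\<forall>i j. P $ j $ i = ocnj (P $ i $ j)) \<and>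
     (\<forall>i k. (\<Sum>j\<in>UNIV. omult (P $ i $ j) (P $ j $ k)) = P $ i $ k) \<and> (\<Sum>i\<in>UNIV. P $ i $ i) = oreal 1"
proof -
  have "jordan_mult P P = omat_mult P P"
    by (simp add: jordan_mult_def flip: scaleR_2)
  then show ?thesis
    by (auto simp: OP2_def albert_def omat_mult_def otrace_def vec_eq_iff)
qed

text \<open>Since Re(x star(y)) is the Euclidean product, the trace form against a Hermitian matrix
  is the inner product of the matrices; the plane is thus embedded by the identity map.\<close>

lemma OP2_dist_eq:
  assumes "P \<in> OP2" "Q \<in> OP2"
  shows "OP2_dist P Q = arccos (sqrt (P \<bullet> Q))"
proof -
  have "oRe (\<Sum>i\<in>UNIV. omat_mult A B $ i $ i) = A \<bullet> B" if "B \<in> OP2" for A B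
  proof -
    have h: "B $ j $ i = ocnj (B $ i $ j)" for i j
      using that unfolding OP2_iff by blast
    have "omat_mult A B $ i $ i = (\<Sum>j\<in>UNIV. omult (A $ i $ j) (ocnj (B $ i $ j)))" for i
      by (simp add: omat_mult_def h[where i = i])
    then show ?thesis
      by (simp add: oRe_sum oRe_omult_ocnj inner_vec_def)
  qed
  from this[OF assms(1), of Q] this[OF assms(2), of P]
  have "oRe (otrace (jordan_mult P Q)) = P \<bullet> Q"
    by (simp add: otrace_def jordan_mult_def oRe_sum oRe_simps sum.distrib inner_commute
        flip: scaleR_sum_right)
  then show ?thesis
    by (simp add: OP2_dist_def)
qed

lemma UNIV_3_distinct:
  fixes i j k :: 3
  assumes "i \<noteq> j" "j \<noteq> k" "i \<noteq> k"
  shows "(UNIV :: 3 set) = {i, j, k}"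
  using assms by (intro card_subset_eq[symmetric]) auto

lemma exists_distinct_3:
  fixes i j :: 3
  obtains k where "k \<noteq> i" "k \<noteq> j"
proof -
  have "card {i, j} < card (UNIV :: 3 set)"
    by (simp add: card_insert_if)
  then have "{i, j} \<noteq> UNIV" by force
  then show thesis using that by blast
qed

text \<open>The relations on the right involve only products of two entries, so they avoid
  bracketing. Summing them over the middle index with trace 1 returns idempotency; the converse
  reads them off the entries of P P = P.\<close>

lemma OP2_rank1:
  "P \<in> OP2 \<longleftrightarrow> (\<forall>i j. P $ j $ i = ocnj (P $ i $ j)) \<and> (\<Sum>i\<in>UNIV. P $ i $ i) = oreal 1 \<and>
     (\<forall>i j k. omult (P $ j $ i) (P $ i $ k) = oRe (P $ i $ i) *\<^sub>R P $ j $ k)"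
    (is "_ \<longleftrightarrow> ?R")
proof
  assume R: ?R
  then have tr: "(\<Sum>i\<in>UNIV. P $ i $ i) = oreal 1" and
    r: "\<And>i j k. omult (P $ j $ i) (P $ i $ k) = oRe (P $ i $ i) *\<^sub>R P $ j $ k"
    by blast+
  have "(\<Sum>j\<in>UNIV. omult (P $ i $ j) (P $ j $ k)) = P $ i $ k" for i k
    using arg_cong[OF tr, of oRe] by (simp add: r oRe_simps oRe_sum flip: scaleR_sum_left)
  then show "P \<in> OP2"
    unfolding OP2_iff using R by blast
next
  assume "P \<in> OP2"
  then have h: "\<And>i j. P $ j $ i = ocnj (P $ i $ j)" and
    id: "\<And>i k. (\<Sum>j\<in>UNIV. omult (P $ i $ j) (P $ j $ k)) = P $ i $ k" and
    tr: "(\<Sum>i\<in>UNIV. P $ i $ i) = oreal 1"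
    unfolding OP2_iff by blast+
  define p where "p i = oRe (P $ i $ i)" for i
  have p: "P $ i $ i = oreal (p i)" for i
    unfolding p_def using h by (intro self_ocnj_real)
  have s: "p i + p j + p k = 1" if "i \<noteq> j" "j \<noteq> k" "i \<noteq> k" for i j k
  proof -
    have "oRe (\<Sum>i\<in>UNIV. P $ i $ i) = 1"
      using tr by (simp add: oRe_simps)
    then show ?thesis
      using that by (simp add: oRe_simps p_def UNIV_3_distinct[OF that] add.assoc)
  qed
  have nsym: "norm (P $ i $ j) = norm (P $ j $ i)" for i j
    by (metis h oct.norm_star)
  have diag: "(norm (P $ i $ j))\<^sup>2 + (norm (P $ i $ k))\<^sup>2 = p i * (p j + p k)"
    if d: "i \<noteq> j" "j \<noteq> k" "i \<noteq> k" for i j k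
  proof -
    have "omult (P $ i $ m) (P $ m $ i) = oreal ((norm (P $ i $ m))\<^sup>2)" for m
      by (metis h omult_ocnj_self)
    then have "(\<Sum>m\<in>UNIV. oreal ((norm (P $ i $ m))\<^sup>2)) = oreal (p i)"
      using id[of i i] p[of i] by simp
    then have "(p i)\<^sup>2 + ((norm (P $ i $ j))\<^sup>2 + (norm (P $ i $ k))\<^sup>2) = p i"
      using d by (simp add: UNIV_3_distinct[OF d] p norm_oreal oreal_arith)
    moreover have eq: "p j + p k = 1 - p i"
      using s[OF d] by simp
    ultimately show ?thesis
      unfolding eq by (simp add: power2_eq_square right_diff_distrib)
  qed
  \<comment> \<open>The three diagonal equations are linear in the three squared norms of the
    off-diagonal entries; solving them gives these values.\<close>
  have minor: "(norm (P $ i $ j))\<^sup>2 = p i * p j" if ij: "i \<noteq> j" for i j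
  proof -
    obtain k where k: "k \<noteq> i" "k \<noteq> j" by (rule exists_distinct_3)
    show ?thesis
      using diag[of i j k] diag[of j i k] diag[of k i j] ij k nsym[of i j] nsym[of i k] nsym[of j k]
      by (simp add: algebra_simps)
  qed
  have "omult (P $ j $ i) (P $ i $ k) = p i *\<^sub>R P $ j $ k" for i j k
  proof -
    consider "j = i" | "k = i" | "j \<noteq> i" "j = k" | "j \<noteq> i" "k \<noteq> i" "j \<noteq> k" by blast
    then show ?thesis
    proof cases
      case 3
      have "omult (P $ j $ i) (P $ i $ j) = oreal ((norm (P $ j $ i))\<^sup>2)"
        by (metis h omult_ocnj_self)
      then show ?thesis
        using minor[of j i] 3 by (simp add: p oreal_arith mult.commute)
    next
      \<comment> \<open>Entry (j, k) of P P = P has two terms with a real diagonal factor; removing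
        them leaves the factor 1 - p_j - p_k, which is p_i by the trace.\<close>
      case 4
      then have "omult (P $ j $ i) (P $ i $ k) + p j *\<^sub>R P $ j $ k + p k *\<^sub>R P $ j $ k = P $ j $ k"
        using id[of j k] by (simp add: UNIV_3_distinct[of i j k] p add.assoc)
      moreover have eq: "p i = 1 - p j - p k"
        using s[of i j k] 4 by simp
      ultimately show ?thesis
        unfolding eq scaleR_left_diff_distrib scaleR_one by (simp add: eq_diff_eq ac_simps)
    qed (simp_all add: p)
  qed
  then show ?R
    unfolding p_def using h tr by blast
qed

lemma OP2_diag_real: "P \<in> OP2 \<Longrightarrow> P $ i $ i = oreal (oRe (P $ i $ i))"
  unfolding OP2_rank1 by (intro self_ocnj_real) blast

text \<open>The vector is the i-th column divided by \<open>p i\<close>; by the rank one relations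
  its squared length is \<open>1 / p i\<close>, and its projection returns \<open>P\<close>.\<close>

lemma OP2_chart:
  assumes P: "P \<in> OP2" and nz: "P $ i $ i \<noteq> 0"
  shows "\<exists>w. w $ i = oreal 1 \<and> P = oct.proj w"
proof -
  have h: "\<And>i j. P $ j $ i = ocnj (P $ i $ j)" and tr: "(\<Sum>i\<in>UNIV. P $ i $ i) = oreal 1" and
    r: "\<And>i j k. omult (P $ j $ i) (P $ i $ k) = oRe (P $ i $ i) *\<^sub>R P $ j $ k"
    using P unfolding OP2_rank1 by blast+
  define p where "p i = oRe (P $ i $ i)" for i
  have p: "P $ i $ i = oreal (p i)" for i
    unfolding p_def by (rule OP2_diag_real[OF P])
  have pi: "p i \<noteq> 0"
    using nz p[of i] by (auto simp: oreal_arith)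
  have n: "(norm (P $ j $ i))\<^sup>2 = p i * p j" for j
  proof -
    have "oreal ((norm (P $ j $ i))\<^sup>2) = oreal (p i * p j)"
      using r[of j i j] by (metis h omult_ocnj_self oreal_arith(3) p p_def)
    then show ?thesis by simp
  qed
  define w where "w = (\<chi> j. (1 / p i) *\<^sub>R P $ j $ i)"
  have w_nth: "w $ j = (1 / p i) *\<^sub>R P $ j $ i" for j
    by (simp add: w_def)
  have sp: "(\<Sum>j\<in>UNIV. p j) = 1"
    using arg_cong[OF tr, of oRe] by (simp add: oRe_sum oRe_simps p_def)
  have nw: "(norm w)\<^sup>2 = 1 / p i"
  proof -
    have "(norm w)\<^sup>2 = (\<Sum>j\<in>UNIV. (p i * p j) / (p i)\<^sup>2)"
      by (simp add: oct.power2_norm_vec w_nth power_divide n)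
    also have "\<dots> = (\<Sum>j\<in>UNIV. p j) / p i"
      using pi by (simp add: power2_eq_square flip: sum_divide_distrib sum_distrib_left)
    finally show ?thesis by (simp add: sp)
  qed
  have "oct.proj w $ j $ k = P $ j $ k" for j k
  proof -
    have "omult (P $ j $ i) (ocnj (P $ k $ i)) = p i *\<^sub>R P $ j $ k"
      using r[of j i k] h[of k i] by (simp add: p_def)
    then show ?thesis
      using pi by (simp add: oct.proj_def nw oct.outer_def w_nth oct.mul_simps oct.star_simps)
  qed
  moreover have "w $ i = oreal 1"
    using pi by (simp add: w_nth p oreal_arith)
  ultimately show ?thesis
    by (intro exI[of _ w]) (auto simp: vec_eq_iff)
qed

text \<open>Bracketing could fail only for three distinct indices. As there are only three, one of
  them is \<open>i\<close>, whose coordinate is 1, and the alternative laws handle the remaining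
  product.\<close>

lemma proj_in_OP2:
  fixes w :: "octonion ^ 3"
  assumes w: "w $ i = oreal 1"
  shows "oct.proj w \<in> OP2"
proof -
  have nz: "norm w \<noteq> 0"
    using Finite_Cartesian_Product.norm_nth_le[of w i] w by (auto simp: norm_oreal)
  have prod: "omult (omult (w $ j) (ocnj (w $ l))) (omult (w $ l) (ocnj (w $ k)))
      = (norm (w $ l))\<^sup>2 *\<^sub>R omult (w $ j) (ocnj (w $ k))" for j k l
  proof -
    have alt1: "omult (omult x (ocnj y)) y = (norm y)\<^sup>2 *\<^sub>R x" for x y
      using omult_cancel_right[of x "ocnj y"] by (simp add: oct.norm_star)
    have alt2: "omult x (omult (ocnj x) y) = (norm x)\<^sup>2 *\<^sub>R y" for x y
      using omult_cancel_left[of "ocnj x" y] by (simp add: oct.norm_star)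
    consider "j = l" | "k = l" | "j = k" | "j \<noteq> l" "k \<noteq> l" "j \<noteq> k" by blast
    then show ?thesis
    proof cases
      case 3
      have "omult (w $ l) (ocnj (w $ k)) = ocnj (omult (w $ j) (ocnj (w $ l)))"
        using 3 by (simp add: ocnj_omult)
      then show ?thesis
        using 3 by (simp add: omult_ocnj_self norm_omult oct.norm_star oreal_arith power_mult_distrib mult.commute)
    next
      case 4
      then have "i \<in> {l, j, k}"
        using UNIV_3_distinct[of l j k] by blast
      then show ?thesis
        using w by (auto simp: omult_cancel_left alt1 norm_oreal oct.mul_one oct.one_mul)
    qed (simp_all add: omult_ocnj_self)
  qed
  have d: "oct.proj w $ j $ j = oreal ((norm (w $ j))\<^sup>2 / (norm w)\<^sup>2)" for j
    by (simp add: oct.proj_def oct.outer_def omult_ocnj_self oreal_arith)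
  show ?thesis
    unfolding OP2_rank1
  proof (intro conjI allI)
    show "oct.proj w $ j $ i = ocnj (oct.proj w $ i $ j)" for i j
      by (simp add: oct.proj_def oct.outer_def oct.star_simps ocnj_omult)
    have "(\<Sum>j\<in>UNIV. (norm (w $ j))\<^sup>2) = (norm w)\<^sup>2"
      by (simp add: oct.power2_norm_vec)
    then have "(norm (w $ 1))\<^sup>2 + (norm (w $ 2))\<^sup>2 + (norm (w $ 3))\<^sup>2 = (norm w)\<^sup>2"
      by (simp add: sum_3)
    then show "(\<Sum>i\<in>UNIV. oct.proj w $ i $ i) = oreal 1"
      using nz by (simp add: d sum_3 oreal_arith flip: add_divide_distrib)
    show "omult (oct.proj w $ j $ l) (oct.proj w $ l $ k) = oRe (oct.proj w $ l $ l) *\<^sub>R oct.proj w $ j $ k" for j k l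
      by (simp add: d oRe_simps) (simp add: oct.proj_def oct.outer_def oct.mul_simps prod)
  qed
qed

section \<open>Isometries of the octonionic plane\<close>

lemma OP2_iff_mult:
  "P \<in> OP2 \<longleftrightarrow> (\<forall>i j. P $ j $ i = ocnj (P $ i $ j)) \<and> omat_mult P P = P \<and> otrace P = oreal 1"
  unfolding OP2_iff by (simp add: vec_eq_iff omat_mult_def otrace_def)

definition lact :: "real ^ 3 ^ 3 \<Rightarrow> omatrix \<Rightarrow> omatrix" where
  "lact R P = (\<chi> i j. \<Sum>k\<in>UNIV. R $ i $ k *\<^sub>R P $ k $ j)"

definition ract :: "real ^ 3 ^ 3 \<Rightarrow> omatrix \<Rightarrow> omatrix" where
  "ract R P = (\<chi> i j. \<Sum>l\<in>UNIV. R $ j $ l *\<^sub>R P $ i $ l)"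

text \<open>The conjugation of P by R and its transpose. Real entries commute and associate with
  octonions, so the two one-sided actions can be treated separately.\<close>

definition real_conj :: "real ^ 3 ^ 3 \<Rightarrow> omatrix \<Rightarrow> omatrix" where
  "real_conj R P = lact R (ract R P)"

lemma omult_sum_left: "omult (sum f A) y = (\<Sum>k\<in>A. omult (f k) y)"
  and omult_sum_right: "omult x (sum f A) = (\<Sum>k\<in>A. omult x (f k))"
proof -
  have "linear (\<lambda>x. omult x y)" "linear (omult x)"
    using oct.bilinear_mul unfolding bilinear_def by blast+
  then show "omult (sum f A) y = (\<Sum>k\<in>A. omult (f k) y)" "omult x (sum f A) = (\<Sum>k\<in>A. omult x (f k))"
    using linear_sum[of "\<lambda>x. omult x y" f A] linear_sum[of "omult x" f A] by blast+
qed

text \<open>Symmetric orthogonal matrices are their own inverses, so the conjugation is an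
  involution and serves as its own witness of bijectivity.\<close>

context
  fixes R :: "real ^ 3 ^ 3"
  assumes sym: "\<And>i j. R $ i $ j = R $ j $ i"
    and invol: "\<And>i j. (\<Sum>k\<in>UNIV. R $ i $ k * R $ k $ j) = (if i = j then 1 else 0)"
begin

lemma lact_lact: "lact R (lact R P) = P"
proof -
  have "(\<Sum>k\<in>UNIV. R $ i $ k *\<^sub>R (\<Sum>a\<in>UNIV. R $ k $ a *\<^sub>R P $ a $ j)) = P $ i $ j" for i j
  proof -
    have "(\<Sum>k\<in>UNIV. R $ i $ k *\<^sub>R (\<Sum>a\<in>UNIV. R $ k $ a *\<^sub>R P $ a $ j))
        = (\<Sum>a\<in>UNIV. (\<Sum>k\<in>UNIV. R $ i $ k * R $ k $ a) *\<^sub>R P $ a $ j)"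
      unfolding scaleR_sum_right scaleR_sum_left by (subst sum.swap) simp
    then show ?thesis by (simp add: invol if_distrib[of "\<lambda>c. c *\<^sub>R _"] cong: if_cong)
  qed
  then show ?thesis by (simp add: lact_def vec_eq_iff)
qed

lemma ract_eq_transpose: "ract R P = transpose (lact R (transpose P))"
  by (simp add: ract_def lact_def transpose_def vec_eq_iff)

lemma ract_ract: "ract R (ract R P) = P"
  by (simp add: ract_eq_transpose lact_lact)

lemma lact_ract: "lact R (ract R P) = ract R (lact R P)"
  by (simp add: lact_def ract_def vec_eq_iff scaleR_sum_right mult.commute) (subst sum.swap, simp)

lemma real_conj_invol: "real_conj R (real_conj R P) = P"
  by (simp add: real_conj_def lact_ract lact_lact ract_ract)

lemma inner_lact: "lact R P \<bullet> Q = P \<bullet> lact R Q"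
proof -
  have "lact R P \<bullet> Q = (\<Sum>i\<in>UNIV. \<Sum>j\<in>UNIV. \<Sum>k\<in>UNIV. R $ i $ k * (P $ k $ j \<bullet> Q $ i $ j))"
    by (simp add: lact_def inner_vec_def inner_sum_left)
  also have "\<dots> = (\<Sum>k\<in>UNIV. \<Sum>j\<in>UNIV. \<Sum>i\<in>UNIV. R $ i $ k * (P $ k $ j \<bullet> Q $ i $ j))"
    by (subst sum.swap, subst (2) sum.swap, subst sum.swap) simp
  also have "\<dots> = (\<Sum>k\<in>UNIV. \<Sum>j\<in>UNIV. \<Sum>i\<in>UNIV. R $ k $ i * (P $ k $ j \<bullet> Q $ i $ j))"
    by (intro sum.cong refl, subst sym, rule refl)
  also have "\<dots> = P \<bullet> lact R Q"
    by (simp add: lact_def inner_vec_def inner_sum_right)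
  finally show ?thesis .
qed

lemma inner_transpose: "transpose (P :: omatrix) \<bullet> transpose Q = P \<bullet> Q"
  by (simp add: inner_vec_def transpose_def) (rule sum.swap)

lemma inner_ract: "ract R P \<bullet> Q = P \<bullet> ract R Q"
  unfolding ract_eq_transpose
  by (metis inner_lact inner_transpose transpose_transpose)

lemma inner_real_conj: "real_conj R P \<bullet> real_conj R Q = P \<bullet> Q"
  by (simp add: real_conj_def inner_lact lact_lact inner_ract ract_ract)

lemma omat_mult_lact: "omat_mult (lact R P) Q = lact R (omat_mult P Q)"
  by (simp add: omat_mult_def lact_def vec_eq_iff omult_sum_left oct.mul_simps scaleR_sum_right)
    (subst sum.swap, simp)

lemma omat_mult_ract: "omat_mult P (ract R Q) = ract R (omat_mult P Q)"
  by (simp add: omat_mult_def ract_def vec_eq_iff omult_sum_right oct.mul_simps scaleR_sum_right)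
    (subst sum.swap, simp)

text \<open>In a product of two conjugates this brings the two inner copies of \<open>R\<close>
  together, where they cancel by \<open>lact_lact\<close>.\<close>

lemma omat_mult_ract_left: "omat_mult (ract R P) Q = omat_mult P (lact R Q)"
proof -
  have "(\<Sum>k\<in>UNIV. omult (\<Sum>l\<in>UNIV. R $ k $ l *\<^sub>R P $ i $ l) (Q $ k $ j))
      = (\<Sum>k\<in>UNIV. omult (P $ i $ k) (\<Sum>l\<in>UNIV. R $ k $ l *\<^sub>R Q $ l $ j))" for i j
  proof -
    have "(\<Sum>k\<in>UNIV. omult (\<Sum>l\<in>UNIV. R $ k $ l *\<^sub>R P $ i $ l) (Q $ k $ j))
      = (\<Sum>k\<in>UNIV. \<Sum>l\<in>UNIV. R $ l $ k *\<^sub>R omult (P $ i $ l) (Q $ k $ j))"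
      by (simp add: omult_sum_left oct.mul_simps) (intro sum.cong refl, subst sym, rule refl)
    also have "\<dots> = (\<Sum>k\<in>UNIV. omult (P $ i $ k) (\<Sum>l\<in>UNIV. R $ k $ l *\<^sub>R Q $ l $ j))"
      by (subst sum.swap) (simp add: omult_sum_right oct.mul_simps)
    finally show ?thesis .
  qed
  then show ?thesis by (simp add: omat_mult_def lact_def ract_def vec_eq_iff)
qed

lemma otrace_lact: "otrace (lact R P) = otrace (ract R P)"
proof -
  have "(\<Sum>i\<in>UNIV. \<Sum>k\<in>UNIV. R $ i $ k *\<^sub>R P $ k $ i) = (\<Sum>k\<in>UNIV. \<Sum>i\<in>UNIV. R $ k $ i *\<^sub>R P $ k $ i)"
    by (subst sum.swap) (intro sum.cong refl, subst sym, rule refl)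
  then show ?thesis by (simp add: otrace_def lact_def ract_def)
qed

lemma real_conj_OP2:
  assumes "P \<in> OP2"
  shows "real_conj R P \<in> OP2"
  unfolding OP2_iff_mult
proof (intro conjI allI)
  have h: "ocnj (P $ i $ j) = P $ j $ i" for i j
    using assms unfolding OP2_iff_mult by metis
  have m: "omat_mult P P = P" and tr: "otrace P = oreal 1"
    using assms unfolding OP2_iff_mult by blast+
  show "real_conj R P $ j $ i = ocnj (real_conj R P $ i $ j)" for i j
    by (simp add: real_conj_def lact_def ract_def linear_sum[OF oct.linear_star] oct.star_simps h
        scaleR_sum_right mult.commute) (subst sum.swap, simp)
  show "omat_mult (real_conj R P) (real_conj R P) = real_conj R P"
    by (simp add: real_conj_def omat_mult_lact)
      (simp add: omat_mult_ract_left lact_lact omat_mult_ract m)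
  show "otrace (real_conj R P) = oreal 1"
    by (simp add: real_conj_def otrace_lact ract_ract tr)
qed

lemma real_conj_isometry: "isometry_of OP2 OP2_dist (real_conj R)"
  by (rule isometry_ofI[where g = "real_conj R"])
    (simp_all add: real_conj_OP2 real_conj_invol OP2_dist_eq inner_real_conj)

end

text \<open>
  The maps \<open>a \<mapsto> u\<^sup>* a u\<^sup>*\<close>, \<open>b \<mapsto> u b\<close>, \<open>c \<mapsto> c u\<close> on the off-diagonal entries
  \<open>a = P\<^sub>2\<^sub>3\<close>, \<open>b = P\<^sub>3\<^sub>1\<close>, \<open>c = P\<^sub>1\<^sub>2\<close> respect the products of pairs by the Moufang identities.
\<close>

definition phase :: "octonion \<Rightarrow> omatrix \<Rightarrow> omatrix" where
  "phase u P = vector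
    [vector [P $ 1 $ 1, omult (P $ 1 $ 2) u, omult (P $ 1 $ 3) (ocnj u)],
     vector [omult (ocnj u) (P $ 2 $ 1), P $ 2 $ 2, omult (ocnj u) (omult (P $ 2 $ 3) (ocnj u))],
     vector [omult u (P $ 3 $ 1), omult u (omult (P $ 3 $ 2) u), P $ 3 $ 3]]"

lemma phase_nth:
  "phase u P $ 1 $ 1 = P $ 1 $ 1" "phase u P $ 2 $ 2 = P $ 2 $ 2" "phase u P $ 3 $ 3 = P $ 3 $ 3"
  "phase u P $ 1 $ 2 = omult (P $ 1 $ 2) u" "phase u P $ 1 $ 3 = omult (P $ 1 $ 3) (ocnj u)"
  "phase u P $ 2 $ 1 = omult (ocnj u) (P $ 2 $ 1)"
  "phase u P $ 2 $ 3 = omult (ocnj u) (omult (P $ 2 $ 3) (ocnj u))"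
  "phase u P $ 3 $ 1 = omult u (P $ 3 $ 1)" "phase u P $ 3 $ 2 = omult u (omult (P $ 3 $ 2) u)"
  by (simp_all add: phase_def)

lemma unit_cancel:
  assumes "norm u = 1"
  shows "omult (ocnj u) (omult u y) = y" "omult u (omult (ocnj u) y) = y"
    "omult (omult y u) (ocnj u) = y" "omult (omult y (ocnj u)) u = y"
  using omult_cancel_left[of u y] omult_cancel_left[of "ocnj u" y]
    omult_cancel_right[of y u] omult_cancel_right[of y "ocnj u"] assms
  by (simp_all add: oct.norm_star)

text \<open>Each line is a left or right Moufang identity at an argument already multiplied by a
  unit, where the inner pair of conjugate units cancels.\<close>

lemma unit_moufang:
  assumes u: "norm u = 1"
  shows "omult (omult y u) (omult (ocnj u) (omult z (ocnj u))) = omult (omult y z) (ocnj u)"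
    and "omult (omult u (omult z u)) (omult (ocnj u) y) = omult u (omult z y)"
    and "omult (omult y (ocnj u)) (omult u (omult z u)) = omult (omult y z) u"
    and "omult (omult (ocnj u) (omult z (ocnj u))) (omult u y) = omult (ocnj u) (omult z y)"
  using right_moufang[of "omult y u" "ocnj u" z] left_moufang[of u z "omult (ocnj u) y"]
    right_moufang[of "omult y (ocnj u)" u z] left_moufang[of "ocnj u" z "omult u y"]
  by (simp_all add: unit_cancel[OF u])

text \<open>For three distinct indices the rank one relations are the Moufang identities. With
  coinciding indices they depend only on diagonal entries and norms, which the map
  preserves.\<close>

lemma phase_OP2:
  assumes P: "P \<in> OP2" and u: "norm u = 1"
  shows "phase u P \<in> OP2"
proof -
  have h: "\<And>i j. ocnj (P $ i $ j) = P $ j $ i" and tr: "(\<Sum>i\<in>UNIV. P $ i $ i) = oreal 1" and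
    r: "\<And>i j k. omult (P $ j $ i) (P $ i $ k) = oRe (P $ i $ i) *\<^sub>R P $ j $ k"
    using P unfolding OP2_rank1 by metis+
  define Q where "Q = phase u P"
  have hQ': "\<forall>i j. ocnj (Q $ i $ j) = Q $ j $ i"
    unfolding forall_3 Q_def by (simp add: phase_nth h ocnj_omult flexible)
  have dQ: "\<forall>i. Q $ i $ i = P $ i $ i"
    unfolding forall_3 Q_def by (simp add: phase_nth)
  have nQ: "\<forall>i j. norm (Q $ i $ j) = norm (P $ i $ j)"
    unfolding forall_3 Q_def by (simp add: phase_nth norm_omult oct.norm_star u)
  have dist: "\<forall>i j k. i \<noteq> j \<longrightarrow> j \<noteq> k \<longrightarrow> i \<noteq> k \<longrightarrow>
      omult (Q $ j $ i) (Q $ i $ k) = oRe (P $ i $ i) *\<^sub>R Q $ j $ k"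
    unfolding forall_3 Q_def
    by (simp add: phase_nth middle_moufang unit_moufang[OF u] r oct.mul_simps)
  have sq: "omult (Q $ j $ i) (Q $ i $ j) = omult (P $ j $ i) (P $ i $ j)" for i j
    using omult_ocnj_self[of "Q $ j $ i"] omult_ocnj_self[of "P $ j $ i"] hQ' h nQ by simp
  have "omult (Q $ j $ i) (Q $ i $ k) = oRe (Q $ i $ i) *\<^sub>R Q $ j $ k" for i j k
  proof -
    have real: "P $ i $ i = oreal (oRe (P $ i $ i))"
      by (rule OP2_diag_real[OF P])
    consider "j = i" | "k = i" | "j = k" | "i \<noteq> j" "j \<noteq> k" "i \<noteq> k" by blast
    then show ?thesis
    proof cases
      case 1
      then show ?thesis using dQ real by (metis omult_oreal(1))
    next
      case 2
      then show ?thesis using dQ real by (metis omult_oreal(2))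
    next
      case 3
      then show ?thesis using sq[of j i] r[of j i j] dQ by simp
    next
      case 4
      then show ?thesis using dist dQ by simp
    qed
  qed
  then show ?thesis
    unfolding OP2_rank1 Q_def[symmetric] using hQ' tr dQ by auto
qed

lemma phase_phase: "norm u = 1 \<Longrightarrow> phase (ocnj u) (phase u P) = P"
proof -
  assume u: "norm u = 1"
  have 1: "omult u (omult (omult (ocnj u) (omult z (ocnj u))) u) = z" for z
    using middle_moufang[of u "ocnj u" "omult z (ocnj u)"] by (simp add: unit_cancel[OF u] omult_ocnj_self u)
  have 2: "omult (ocnj u) (omult (omult u (omult z u)) (ocnj u)) = z" for z
    using middle_moufang[of "ocnj u" u "omult z u"] by (simp add: unit_cancel[OF u] ocnj_omult_self u)
  have "\<forall>i j. phase (ocnj u) (phase u P) $ i $ j = P $ i $ j"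
    unfolding forall_3 by (simp add: phase_nth unit_cancel[OF u] 1 2)
  then show ?thesis by (simp add: vec_eq_iff)
qed

text \<open>The map is additive and preserves each entry's norm; polarisation gives the inner
  product.\<close>

lemma phase_inner:
  assumes u: "norm u = 1"
  shows "phase u P \<bullet> phase u Q = P \<bullet> Q"
proof -
  have "\<forall>i j. phase u (A + B) $ i $ j = (phase u A + phase u B) $ i $ j" for A B
    unfolding forall_3 by (simp add: phase_nth oct.mul_simps)
  then have add: "phase u (A + B) = phase u A + phase u B" for A B
    by (simp add: vec_eq_iff)
  have "(norm (phase u A))\<^sup>2 = (norm A)\<^sup>2" for A
    by (simp add: oct.power2_norm_vec sum_3 phase_nth norm_omult oct.norm_star u)
  then have "norm (phase u A) = norm A" for A
    by (simp add: power2_eq_iff_nonneg)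
  then show ?thesis
    by (simp add: dot_norm flip: add)
qed

lemma phase_isometry: "norm u = 1 \<Longrightarrow> isometry_of OP2 OP2_dist (phase u)"
  by (rule isometry_ofI[where g = "phase (ocnj u)"])
    (use phase_phase[of u] phase_phase[of "ocnj u"] in
      \<open>simp_all add: phase_OP2 oct.norm_star OP2_dist_eq phase_inner\<close>)

section \<open>Transitivity on the octonionic plane\<close>

text \<open>A phase makes the (1, 2) entry real; the upper left block is then a singular real 2 x 2
  matrix, and a reflection whose first row is a kernel vector clears the (1, 1) entry. Index 3 is
  left alone, so a zero already obtained there survives.\<close>

lemma OP2_reduce:
  assumes P: "P \<in> OP2"
  shows "\<exists>f. isometry_of OP2 OP2_dist f \<and> f P $ 1 $ 1 = 0 \<and> (P $ 3 $ 3 = 0 \<longrightarrow> f P $ 3 $ 3 = 0)"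
proof (cases "P $ 1 $ 1 = 0")
  case True
  then show ?thesis
    by (intro exI[of _ "\<lambda>x. x"]) (auto intro: isometry_ofI[where g = "\<lambda>x. x"])
next
  case False
  define u where "u = (if P $ 1 $ 2 = 0 then oreal 1 else (1 / norm (P $ 1 $ 2)) *\<^sub>R ocnj (P $ 1 $ 2))"
  have u: "norm u = 1"
    by (simp add: u_def norm_oreal oct.norm_star)
  define Q where "Q = phase u P"
  have Q: "Q \<in> OP2"
    unfolding Q_def by (rule phase_OP2[OF P u])
  define c where "c = norm (P $ 1 $ 2)"
  have Q12: "Q $ 1 $ 2 = oreal c"
    by (simp add: Q_def phase_nth u_def oct.mul_simps omult_ocnj_self oreal_arith power2_eq_square c_def)
  then have Q21: "Q $ 2 $ 1 = oreal c"
    using Q unfolding OP2_rank1 by (metis ocnj_oreal)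
  define p q where "p = oRe (Q $ 1 $ 1)" and "q = oRe (Q $ 2 $ 2)"
  have Q11: "Q $ 1 $ 1 = oreal p" and Q22: "Q $ 2 $ 2 = oreal q"
    unfolding p_def q_def by (rule OP2_diag_real[OF Q])+
  have "omult (Q $ 1 $ 2) (Q $ 2 $ 1) = q *\<^sub>R Q $ 1 $ 1"
    using Q unfolding OP2_rank1 q_def by blast
  then have cc: "c\<^sup>2 = p * q"
    by (simp add: Q12 Q21 Q11 oreal_arith power2_eq_square mult.commute)
  have p0: "p \<noteq> 0"
    using False Q11 by (auto simp: Q_def phase_nth oreal_arith)
  define s where "s = c\<^sup>2 + p\<^sup>2"
  have s: "s > 0"
    using p0 by (simp add: s_def add_nonneg_pos)
  \<comment> \<open>The vector (-c, p) spans the kernel of the block with rows (p, c) and (c, q),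
    because \<open>c\<^sup>2 = p * q\<close>; division by \<open>sqrt s\<close> normalises
    it.\<close>
  define x y where "x = - c / sqrt s" and "y = p / sqrt s"
  have prods: "x * x = c\<^sup>2 / s" "y * y = p\<^sup>2 / s" "x * y = - (c * p) / s"
    using s by (simp_all add: x_def y_def power2_eq_square)
  then have xy: "x * x + y * y = 1"
    using s p0 by (simp add: s_def flip: add_divide_distrib)
  define R :: "real ^ 3 ^ 3" where "R = vector [vector [x, y, 0], vector [y, - x, 0], vector [0, 0, 1]]"
  have sym: "\<forall>i j. R $ i $ j = R $ j $ i"
    unfolding forall_3 R_def by simp
  have inv: "\<forall>i j. (\<Sum>k\<in>UNIV. R $ i $ k * R $ k $ j) = (if i = j then 1 else 0)"
    unfolding forall_3 sum_3 R_def using xy by (simp add: algebra_simps)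
  have iso: "isometry_of OP2 OP2_dist (real_conj R)"
    using sym inv by (intro real_conj_isometry) auto
  have "real_conj R Q $ 1 $ 1 = oreal (x * (x * p) + x * (y * c) + y * (x * c) + y * (y * q))"
    by (simp add: real_conj_def lact_def ract_def sum_3 R_def Q11 Q12 Q21 Q22 scaleR_right_distrib oreal_arith algebra_simps)
  also have "x * (x * p) + x * (y * c) + y * (x * c) + y * (y * q) = 0"
  proof -
    have "x * (x * p) + x * (y * c) + y * (x * c) + y * (y * q)
        = (x * x) * p + 2 * ((x * y) * c) + (y * y) * q"
      by (simp add: algebra_simps)
    also have "\<dots> = (c\<^sup>2 * p - 2 * (c\<^sup>2 * p) + p\<^sup>2 * q) / s"
      unfolding prods by (simp add: add_divide_distrib diff_divide_distrib power2_eq_square)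
    also have "\<dots> = 0"
      unfolding cc by (simp add: power2_eq_square)
    finally show ?thesis .
  qed
  finally have "real_conj R Q $ 1 $ 1 = 0"
    by (simp add: oreal_arith)
  moreover have "real_conj R Q $ 3 $ 3 = P $ 3 $ 3"
    by (simp add: real_conj_def lact_def ract_def sum_3 R_def Q_def phase_nth)
  moreover have "isometry_of OP2 OP2_dist (\<lambda>P. real_conj R (phase u P))"
    by (rule isometry_of_comp[OF phase_isometry[OF u] iso])
  ultimately show ?thesis
    unfolding Q_def by (intro exI[of _ "\<lambda>P. real_conj R (phase u P)"]) simp
qed

text \<open>A zero on the diagonal annihilates its row and column, since P_ji P_ij = p_i P_jj and
  the two factors have equal norm.\<close>

lemma OP2_two_zeros:
  assumes P: "P \<in> OP2" and "P $ 1 $ 1 = 0" "P $ 3 $ 3 = 0"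
  shows "P = axis 2 (axis 2 (oreal 1))"
proof -
  have h: "\<And>i j. P $ j $ i = ocnj (P $ i $ j)" and tr: "(\<Sum>i\<in>UNIV. P $ i $ i) = oreal 1" and
    r: "\<And>i j k. omult (P $ j $ i) (P $ i $ k) = oRe (P $ i $ i) *\<^sub>R P $ j $ k"
    using P unfolding OP2_rank1 by blast+
  have z: "P $ j $ i = 0 \<and> P $ i $ j = 0" if "P $ i $ i = 0" for i j
  proof -
    have "omult (P $ j $ i) (P $ i $ j) = 0"
      using r[of j i j] that by (simp add: oRe_simps)
    then have "norm (P $ j $ i) * norm (P $ i $ j) = 0"
      by (metis norm_omult norm_zero)
    moreover have "norm (P $ j $ i) = norm (P $ i $ j)"
      by (metis h oct.norm_star)
    ultimately show ?thesis by simp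
  qed
  have "P $ 2 $ 2 = oreal 1"
    using tr assms by (simp add: sum_3)
  then have "\<forall>i j. P $ i $ j = axis 2 (axis 2 (oreal 1)) $ i $ j"
    unfolding forall_3 using z[of 1] z[of 3] assms by (simp add: axis_def)
  then show ?thesis
    by (simp only: vec_eq_iff) blast
qed

text \<open>Clearing the (1, 1) entry, swapping the indices 1 and 3, and clearing (1, 1) again
  leaves the whole trace on index 2.\<close>

lemma OP2_to_base_point:
  assumes P: "P \<in> OP2"
  shows "\<exists>f. isometry_of OP2 OP2_dist f \<and> f P = axis 2 (axis 2 (oreal 1))"
proof -
  define R :: "real ^ 3 ^ 3" where "R = vector [vector [0, 0, 1], vector [0, 1, 0], vector [1, 0, 0]]"
  have sym: "\<forall>i j. R $ i $ j = R $ j $ i"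
    unfolding forall_3 R_def by simp
  have inv: "\<forall>i j. (\<Sum>k\<in>UNIV. R $ i $ k * R $ k $ j) = (if i = j then 1 else 0)"
    unfolding forall_3 sum_3 R_def by simp
  have iso: "isometry_of OP2 OP2_dist (real_conj R)"
    using sym inv by (intro real_conj_isometry) auto
  have swap: "real_conj R A $ 3 $ 3 = A $ 1 $ 1" for A
    by (simp add: real_conj_def lact_def ract_def sum_3 R_def)
  have mem: "f A \<in> OP2" if "isometry_of OP2 OP2_dist f" "A \<in> OP2" for f A
    using that by (auto simp: isometry_of_def bij_betw_def)
  obtain f where f: "isometry_of OP2 OP2_dist f" "f P $ 1 $ 1 = 0"
    using OP2_reduce[OF P] by blast
  define Q where "Q = real_conj R (f P)"
  have Q: "Q \<in> OP2" "Q $ 3 $ 3 = 0"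
    using mem[OF iso mem[OF f(1) P]] swap f(2) by (simp_all add: Q_def)
  obtain g where g: "isometry_of OP2 OP2_dist g" "g Q $ 1 $ 1 = 0" "g Q $ 3 $ 3 = 0"
    using OP2_reduce[OF Q(1)] Q(2) by blast
  have "g (real_conj R (f P)) = axis 2 (axis 2 (oreal 1))"
    using OP2_two_zeros[OF mem[OF g(1) Q(1)]] g by (simp add: Q_def)
  then show ?thesis
    using isometry_of_comp[OF isometry_of_comp[OF f(1) iso] g(1)] by blast
qed

lemma OP2_transitive:
  assumes "P \<in> OP2" "Q \<in> OP2"
  shows "\<exists>f. isometry_of OP2 OP2_dist f \<and> f P = Q"
proof -
  obtain f g where f: "isometry_of OP2 OP2_dist f" "f P = axis 2 (axis 2 (oreal 1))"
    and g: "isometry_of OP2 OP2_dist g" "g Q = axis 2 (axis 2 (oreal 1))"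
    using OP2_to_base_point assms by metis
  obtain g' where "isometry_of OP2 OP2_dist g'" "g' (g Q) = Q"
    using isometry_of_inv[OF g(1) assms(2)] by blast
  then show ?thesis
    using isometry_of_comp[OF f(1), of g'] f(2) g(2) by metis
qed

lemma rank1_space_OP2: "rank1_space omult ocnj (oreal 1) OP2 OP2_dist (\<lambda>P. P) ((3 - 1) * 8)"
proof (intro rank1_space.intro star_algebra_octonion rank1_space_axioms.intro)
  fix P :: omatrix assume P: "P \<in> OP2"
  have "(\<Sum>i\<in>UNIV. P $ i $ i) \<noteq> 0"
    using P unfolding OP2_rank1 by (metis norm_oreal norm_zero abs_one zero_neq_one)
  then show "\<exists>i. P $ i $ i \<noteq> 0"
    by (meson sum.neutral)
qed (use OP2_dist_eq OP2_transitive OP2_chart proj_in_OP2 in auto)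

theorem theorem3:
  assumes d: "CARD('n::finite) \<ge> 2"
  shows
    "(\<forall>\<sigma> (X :: nat \<Rightarrow> (real ^ 'n) set set).
        invariant_prob RP RP_dist \<sigma> \<longrightarrow> point_sets RP X \<longrightarrow>
        hyperuniform_threshold RP RP_dist \<sigma> (CARD('n) - 1) X \<longrightarrow>
        uniformly_distributed RP RP_dist \<sigma> X)
   \<and> (\<forall>\<sigma> (X :: nat \<Rightarrow> (complex ^ 'n) set set).
        invariant_prob CP CP_dist \<sigma> \<longrightarrow> point_sets CP X \<longrightarrow>
        hyperuniform_threshold CP CP_dist \<sigma> ((CARD('n) - 1) * 2) X \<longrightarrow>
        uniformly_distributed CP CP_dist \<sigma> X)
   \<and> (\<forall>\<sigma> (X :: nat \<Rightarrow> (quaternion ^ 'n) set set).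
        invariant_prob HP HP_dist \<sigma> \<longrightarrow> point_sets HP X \<longrightarrow>
        hyperuniform_threshold HP HP_dist \<sigma> ((CARD('n) - 1) * 4) X \<longrightarrow>
        uniformly_distributed HP HP_dist \<sigma> X)
   \<and> (\<forall>\<sigma> (X :: nat \<Rightarrow> omatrix set).
        invariant_prob OP2 OP2_dist \<sigma> \<longrightarrow> point_sets OP2 X \<longrightarrow>
        hyperuniform_threshold OP2 OP2_dist \<sigma> ((3 - 1) * 8) X \<longrightarrow>
        uniformly_distributed OP2 OP2_dist \<sigma> X)"
  proof -
  interpret real: assoc_star_algebra "(*)" "\<lambda>x. x" "1::real"
    by (rule assoc_star_algebra_real)
  interpret complex: assoc_star_algebra "(*)" cnj "1::complex"
    by (rule assoc_star_algebra_complex)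
  interpret quat: assoc_star_algebra qmult qcnj "(1, 0)"
    by (rule assoc_star_algebra_quaternion)
  note RP = rank1_space.hyperuniform_imp_uniform[OF real.rank1_space_proj_space[OF d], folded RP_def RP_dist_def]
  note CP = rank1_space.hyperuniform_imp_uniform[OF complex.rank1_space_proj_space[OF d], folded CP_def CP_dist_def]
  note HP = rank1_space.hyperuniform_imp_uniform[OF quat.rank1_space_proj_space[OF d], folded HP_def HP_dist_def]
  note OP2 = rank1_space.hyperuniform_imp_uniform[OF rank1_space_OP2]
  have dims: "DIM(real) = 1" "DIM(complex) = 2" "DIM(quaternion) = 4"
    by simp_all
  show ?thesis
    using RP CP HP OP2 unfolding dims mult_1_right by blast
qed

end
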